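(* Let $G$ be a bridgeless cubic graph, and let $C_1,C_2,\dots,C_t$ be a collection of closed walks in $G$. If $C_1,\dots,C_t$ form a partial CDC, then there is an embedding $(\pi,\lambda)$ of $G$ such that $C_1,\dots,C_t$ are some of the facial walks of $(\pi,\lambda)$. Moreover, such an embedding can be found by a linear time algorithm.
   Context: Graphs are finite and simple. A graph is cubic if all vertices have degree $3$; a bridge is an edge whose removal increases the number of components; a graph is bridgeless if it has no bridge. A closed walk is a sequence $(v_0,e_0,v_1,e_1,\dots,e_{n-1},v_n)$ with $n\ge1$, $v_0=v_n$ and $e_i=\{v_i,v_{i+1}\}$ for every $i$. A collection of closed walks $C_1,\dots,C_t$ in $G$ forms a partial circuit double cover (partial CDC) if: (C1) each edge is covered at most once in total by the walks $C_i$, or exactly twice, by two different walks $C_i$ and $C_j$ (once each); (C2) for every vertex $v$ and edges $e,f$ with $e\cap f=\{v\}$, there is at most one index $i$ such that $\{e,f\}\subseteq E(C_i)$. An embedding of a graph $G$ is given combinatorially as a pair $(\pi,\lambda)$, where $\pi=\{\pi_v : v\in V(G)\}$ is a rotation system ($\pi_v$ is a cyclic permutation of the edges incident with $v$) and $\lambda:E(G)\to\{-1,1\}$ is a signature. A facial walk of $(\pi,\lambda)$ is a closed walk $(v_0,e_0,v_1,e_1,\dots,e_{n-1},v_n)$ with $v_n=v_0$, $e_n=e_0$, together with a choice $\varepsilon\in\{-1,1\}$ (the side of $e_0$ being used), such that for each $i\in\{1,\dots,n\}$, with $\mu_i=\varepsilon\lambda(e_0)\lambda(e_1)\cdots\lambda(e_{i-1})$,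 one has $e_i=\pi_{v_i}(e_{i-1})$ if $\mu_i=1$ and $e_i=\pi_{v_i}^{-1}(e_{i-1})$ if $\mu_i=-1$; the walk closes the first time that it is about to traverse $e_0$ from $v_0$ again with the initial side $\varepsilon$ (i.e. $\mu_n=\varepsilon$). Cyclic shifts and reversals of a facial walk are considered the same facial walk. *)

theory Defs
  imports "HOL-Combinatorics.Combinatorics"
begin

section \<open>Graphs\<close>

text \<open>A graph is given by its vertex set \<open>V\<close> and its set \<open>E\<close> of two-element edges.\<close>

definition simple_graph :: "'a set \<Rightarrow> 'a set set \<Rightarrow> bool" where
  "simple_graph V E \<longleftrightarrow> finite V \<and> (\<forall>e\<in>E. e \<subseteq> V \<and> card e = 2)"

definition incident :: "'a set set \<Rightarrow> 'a \<Rightarrow> 'a set set" where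
  "incident E v = {e \<in> E. v \<in> e}"

definition cubic :: "'a set \<Rightarrow> 'a set set \<Rightarrow> bool" where
  "cubic V E \<longleftrightarrow> (\<forall>v\<in>V. card (incident E v) = 3)"

definition components :: "'a set \<Rightarrow> 'a set set \<Rightarrow> 'a set set" where
  "components V E = (\<lambda>u. {v \<in> V. (u, v) \<in> {(x, y). {x, y} \<in> E}\<^sup>*}) ` V"

definition bridge :: "'a set \<Rightarrow> 'a set set \<Rightarrow> 'a set \<Rightarrow> bool" where
  "bridge V E e \<longleftrightarrow> e \<in> E \<and> card (components V (E - {e})) > card (components V E)"

definition bridgeless :: "'a set \<Rightarrow> 'a set set \<Rightarrow> bool" where
  "bridgeless V E \<longleftrightarrow> (\<forall>e\<in>E. \<not> bridge V E e)"

section \<open>Closed walks and partial circuit double covers\<close>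

text \<open>The walk \<open>(v\<^sub>0, e\<^sub>0, v\<^sub>1, \<dots>, e\<^bsub>n-1\<^esub>, v\<^sub>n)\<close> is stored as the pair
  \<open>([v\<^sub>0, \<dots>, v\<^sub>n], [e\<^sub>0, \<dots>, e\<^bsub>n-1\<^esub>])\<close>.\<close>

type_synonym 'a walk = "'a list \<times> 'a set list"

definition closed_walk :: "'a set set \<Rightarrow> 'a walk \<Rightarrow> bool" where
  "closed_walk E = (\<lambda>(vs, es).
     length es \<ge> 1 \<and> length vs = length es + 1 \<and> vs ! 0 = vs ! length es \<and>
     (\<forall>i<length es. es ! i \<in> E \<and> es ! i = {vs ! i, vs ! (i + 1)}))"

definition times_covered :: "'a walk \<Rightarrow> 'a set \<Rightarrow> nat" where
  "times_covered C e = count_list (snd C) e"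

definition partial_CDC :: "'a set \<Rightarrow> 'a set set \<Rightarrow> 'a walk list \<Rightarrow> bool" where
  "partial_CDC V E Cs \<longleftrightarrow>
     (\<forall>C\<in>set Cs. closed_walk E C) \<and>
     (\<forall>e\<in>E.
        (\<Sum>i<length Cs. times_covered (Cs ! i) e) \<le> 1 \<or>
        ((\<Sum>i<length Cs. times_covered (Cs ! i) e) = 2 \<and>
         (\<exists>i<length Cs. \<exists>j<length Cs. i \<noteq> j \<and>
            times_covered (Cs ! i) e = 1 \<and> times_covered (Cs ! j) e = 1))) \<and>
     (\<forall>v\<in>V. \<forall>e\<in>E. \<forall>f\<in>E. e \<inter> f = {v} \<longrightarrow>
        card {i. i < length Cs \<and> {e, f} \<subseteq> set (snd (Cs ! i))} \<le> 1)"

section \<open>Embeddings and facial walks\<close>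

text \<open>\<open>cyclic_on\<close> is false on the empty set, so an isolated vertex carries the identity.
  The signature is called \<open>\<sigma>\<close> here.\<close>

definition embedding ::
    "'a set \<Rightarrow> 'a set set \<Rightarrow> ('a \<Rightarrow> 'a set \<Rightarrow> 'a set) \<Rightarrow> ('a set \<Rightarrow> int) \<Rightarrow> bool" where
  "embedding V E \<pi> \<sigma> \<longleftrightarrow>
     (\<forall>v\<in>V. \<pi> v permutes incident E v \<and>
        (incident E v \<noteq> {} \<longrightarrow> cyclic_on (\<pi> v) (incident E v))) \<and>
     (\<forall>e\<in>E. \<sigma> e \<in> {-1, 1})"

definition side :: "('a set \<Rightarrow> int) \<Rightarrow> 'a set list \<Rightarrow> int \<Rightarrow> nat \<Rightarrow> int" where
  "side \<sigma> es \<epsilon> i = \<epsilon> * (\<Prod>j<i. \<sigma> (es ! j))"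

text \<open>The index \<open>i mod length es\<close> implements the convention \<open>e\<^sub>n = e\<^sub>0\<close>.\<close>

definition facial_walk ::
    "'a set set \<Rightarrow> ('a \<Rightarrow> 'a set \<Rightarrow> 'a set) \<Rightarrow> ('a set \<Rightarrow> int) \<Rightarrow> 'a walk \<Rightarrow> bool" where
  "facial_walk E \<pi> \<sigma> = (\<lambda>(vs, es).
     closed_walk E (vs, es) \<and>
     (\<exists>\<epsilon>\<in>{-1, 1}.
        (\<forall>i\<in>{1..length es}.
           es ! (i mod length es) =
             (if side \<sigma> es \<epsilon> i = 1 then \<pi> (vs ! i) (es ! (i - 1))
              else inv (\<pi> (vs ! i)) (es ! (i - 1)))) \<and>
        side \<sigma> es \<epsilon> (length es) = \<epsilon> \<and>
        (\<forall>k. 0 < k \<and> k < length es \<longrightarrow>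
           \<not> (vs ! k = vs ! 0 \<and> es ! k = es ! 0 \<and> side \<sigma> es \<epsilon> k = \<epsilon>))))"

definition shift_walk :: "nat \<Rightarrow> 'a walk \<Rightarrow> 'a walk" where
  "shift_walk k = (\<lambda>(vs, es).
     let us = rotate k (butlast vs) in (us @ [hd us], rotate k es))"

definition reverse_walk :: "'a walk \<Rightarrow> 'a walk" where
  "reverse_walk = (\<lambda>(vs, es). (rev vs, rev es))"

definition same_walk :: "'a walk \<Rightarrow> 'a walk \<Rightarrow> bool" where
  "same_walk C D \<longleftrightarrow> (\<exists>k. D = shift_walk k C \<or> D = shift_walk k (reverse_walk C))"

text \<open>The walks of the list are facial walks, and pairwise different ones.\<close>

definition some_facial_walks ::
    "'a set set \<Rightarrow> ('a \<Rightarrow> 'a set \<Rightarrow> 'a set) \<Rightarrow> ('a set \<Rightarrow> int) \<Rightarrow> 'a walk list \<Rightarrow> bool" where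
  "some_facial_walks E \<pi> \<sigma> Cs \<longleftrightarrow>
     (\<forall>C\<in>set Cs. facial_walk E \<pi> \<sigma> C) \<and>
     (\<forall>i<length Cs. \<forall>j<length Cs. i \<noteq> j \<longrightarrow> \<not> same_walk (Cs ! i) (Cs ! j))"

section \<open>Linear time\<close>

text \<open>Structured programs on a word RAM: finitely many registers per program, an indirectly
  addressed memory, addition and truncated subtraction. Each assignment, store and test takes
  one step; since the expressions of a fixed program have bounded size, charging for their
  operators would change running times by a constant factor only. The parameter \<open>W\<close> of
  \<open>exec\<close> is the largest word: there is no execution that writes a larger value, or writes to
  a larger address, so a linear bound on \<open>W\<close> means words of logarithmic length.\<close>

datatype expr = Const nat | Reg nat | Mem expr | Add expr expr | Sub expr expr

datatype cond = Less expr expr | Equal expr expr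

datatype prog = Assign nat expr | Store expr expr | Seq prog prog | IfElse cond prog prog
  | While cond prog

type_synonym state = "(nat \<Rightarrow> nat) \<times> (nat \<Rightarrow> nat)"  \<comment> \<open>registers and memory\<close>

fun expr_val :: "expr \<Rightarrow> state \<Rightarrow> nat" where
  "expr_val (Const c) s = c"
| "expr_val (Reg r) s = fst s r"
| "expr_val (Mem a) s = snd s (expr_val a s)"
| "expr_val (Add a b) s = expr_val a s + expr_val b s"
| "expr_val (Sub a b) s = expr_val a s - expr_val b s"

fun cond_val :: "cond \<Rightarrow> state \<Rightarrow> bool" where
  "cond_val (Less a b) s \<longleftrightarrow> expr_val a s < expr_val b s"
| "cond_val (Equal a b) s \<longleftrightarrow> expr_val a s = expr_val b s"

text \<open>\<open>exec W p s k s'\<close>: started in \<open>s\<close>, program \<open>p\<close> halts in \<open>s'\<close> after \<open>k\<close> steps.\<close>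

inductive exec :: "nat \<Rightarrow> prog \<Rightarrow> state \<Rightarrow> nat \<Rightarrow> state \<Rightarrow> bool" for W :: nat where
  Assign: "expr_val a s \<le> W \<Longrightarrow>
    exec W (Assign r a) s 1 ((fst s)(r := expr_val a s), snd s)"
| Store: "expr_val a s \<le> W \<Longrightarrow> expr_val b s \<le> W \<Longrightarrow>
    exec W (Store a b) s 1 (fst s, (snd s)(expr_val a s := expr_val b s))"
| Seq: "exec W p s k s' \<Longrightarrow> exec W q s' l s'' \<Longrightarrow> exec W (Seq p q) s (k + l) s''"
| IfTrue: "cond_val c s \<Longrightarrow> exec W p s k s' \<Longrightarrow> exec W (IfElse c p q) s (1 + k) s'"
| IfFalse: "\<not> cond_val c s \<Longrightarrow> exec W q s k s' \<Longrightarrow> exec W (IfElse c p q) s (1 + k) s'"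
| WhileFalse: "\<not> cond_val c s \<Longrightarrow> exec W (While c p) s 1 s"
| WhileTrue: "cond_val c s \<Longrightarrow> exec W p s k s' \<Longrightarrow> exec W (While c p) s' l s'' \<Longrightarrow>
    exec W (While c p) s (1 + k + l) s''"

text \<open>The input occupies the memory from address 0 on; all other cells and all registers
  are initially 0.\<close>

definition initial_state :: "nat list \<Rightarrow> state" where
  "initial_state xs = (\<lambda>r. 0, \<lambda>a. if a < length xs then xs ! a else 0)"

text \<open>On halting, register 0 holds the address at which the output begins.\<close>

definition outputs :: "state \<Rightarrow> nat list \<Rightarrow> bool" where
  "outputs s ys \<longleftrightarrow> (\<forall>j<length ys. snd s (fst s 0 + j) = ys ! j)"

text \<open>A single program, started on the encoding \<open>enc x\<close> of any instance \<open>x \<in> X\<close>, outputs some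
  \<open>ys\<close> with \<open>sol x ys\<close>, in time linear in the length of the encoding.\<close>

definition linear_time_solvable ::
    "'i set \<Rightarrow> ('i \<Rightarrow> nat list) \<Rightarrow> ('i \<Rightarrow> nat list \<Rightarrow> bool) \<Rightarrow> bool" where
  "linear_time_solvable X enc sol \<longleftrightarrow>
     (\<exists>p K. \<forall>x\<in>X. \<exists>k s ys.
        exec (K * (length (enc x) + 1)) p (initial_state (enc x)) k s \<and>
        k \<le> K * (length (enc x) + 1) \<and> outputs s ys \<and> sol x ys)"

section \<open>Instances and solutions as data\<close>

text \<open>An instance \<open>(n, es, ws)\<close> describes a graph on the vertices \<open>0, \<dots>, n - 1\<close> by the list
  \<open>es\<close> of the end vertices of its edges, in arbitrary order, and closed walks by their
  vertices and the positions of their edges in \<open>es\<close>.\<close>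

type_synonym graph_instance = "nat \<times> (nat \<times> nat) list \<times> (nat list \<times> nat list) list"

definition edge_at :: "(nat \<times> nat) list \<Rightarrow> nat \<Rightarrow> nat set" where
  "edge_at es i = {fst (es ! i), snd (es ! i)}"

definition edges_of :: "(nat \<times> nat) list \<Rightarrow> nat set set" where
  "edges_of es = edge_at es ` {..<length es}"

definition walks_of :: "(nat \<times> nat) list \<Rightarrow> (nat list \<times> nat list) list \<Rightarrow> nat walk list" where
  "walks_of es ws = map (\<lambda>(vs, is). (vs, map (edge_at es) is)) ws"

definition bridgeless_cubic_instances :: "graph_instance set" where
  "bridgeless_cubic_instances = {(n, es, ws).
     inj_on (edge_at es) {..<length es} \<and>
     simple_graph {..<n} (edges_of es) \<and> cubic {..<n} (edges_of es) \<and>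
     bridgeless {..<n} (edges_of es) \<and>
     (\<forall>(vs, is)\<in>set ws. \<forall>i\<in>set is. i < length es) \<and>
     partial_CDC {..<n} (edges_of es) (walks_of es ws)}"

definition encode_instance :: "graph_instance \<Rightarrow> nat list" where
  "encode_instance = (\<lambda>(n, es, ws).
     [n, length es] @ concat (map (\<lambda>(u, v). [u, v]) es) @
     [length ws] @ concat (map (\<lambda>(vs, is). length is # vs @ is) ws))"

text \<open>An embedding of a cubic graph is output as \<open>3 n\<close> edge positions, namely the three edges
  at each vertex in their cyclic order, followed by one entry per edge, which is 0 for
  signature 1 and 1 for signature -1.\<close>

definition encodes_embedding ::
    "nat \<Rightarrow> (nat \<times> nat) list \<Rightarrow> (nat \<Rightarrow> nat set \<Rightarrow> nat set) \<Rightarrow> (nat set \<Rightarrow> int) \<Rightarrow> nat list \<Rightarrow> bool"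
  where
  "encodes_embedding n es \<pi> \<sigma> ys \<longleftrightarrow>
     length ys = 3 * n + length es \<and>
     (\<forall>v<n. (\<forall>j<3. ys ! (3 * v + j) < length es) \<and>
        edge_at es ` {ys ! (3 * v + j) | j. j < 3} = incident (edges_of es) v \<and>
        (\<forall>j<3. \<pi> v (edge_at es (ys ! (3 * v + j))) =
                 edge_at es (ys ! (3 * v + (j + 1) mod 3)))) \<and>
     (\<forall>i<length es. ys ! (3 * n + i) = (if \<sigma> (edge_at es i) = 1 then 0 else 1))"

definition embedding_solution :: "graph_instance \<Rightarrow> nat list \<Rightarrow> bool" where
  "embedding_solution = (\<lambda>(n, es, ws) ys. \<exists>\<pi> \<sigma>.
     embedding {..<n} (edges_of es) \<pi> \<sigma> \<and>
     some_facial_walks (edges_of es) \<pi> \<sigma> (walks_of es ws) \<and>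
     encodes_embedding n es \<pi> \<sigma> ys)"

end

theory Submission
  imports Defs
begin

text \<open>
  A closed walk of a partial CDC repeats no edge, hence at each vertex it uses a pair of the three
  edges, and by (C2) the walks use distinct pairs. Any two edges at a cubic vertex are consecutive
  in any cyclic order, so the rotation system can be chosen arbitrarily. A walk then turns to the
  successor or to the predecessor at each vertex, and it is facial if the signature of each of its
  edges says whether the turns at both ends agree. If two walks share an edge, they take different
  edges at both of its ends, so both of their turns differ and they prescribe the same signature.

  A program computes this in linear time by pushing each edge onto a list at both of its ends, and
  then following all the walks.
\<close>

section \<open>Rotations of cubic graphs\<close>

text \<open>Turning correctly at every vertex is not all that a facial walk needs: it must also
  close at its first return to the initial edge on the initial side. As no walk repeats an edge,
  there is no earlier return on either side. The obstacle is that an edge lying on two walks has its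
  signature prescribed twice. If the walks cross it in the same direction, their turns are opposite
  at each end; if they cross it in opposite directions, the turns of one are those of the other in
  exchanged order. Whether the two turns agree is the same in both cases, so the walks need not be
  oriented coherently. The time is linear because the walks are part of the input, which pays for
  constant work per walk edge. Degree three enters here too: three cells per vertex store a
  rotation, and a successor is found with two comparisons.\<close>

definition three_cycle :: "'b \<Rightarrow> 'b \<Rightarrow> 'b \<Rightarrow> 'b \<Rightarrow> 'b" where
  "three_cycle a b c = (\<lambda>x. if x = a then b else if x = b then c else if x = c then a else x)"

definition rotation3 :: "('b \<Rightarrow> 'b) \<Rightarrow> 'b set \<Rightarrow> bool" where
  "rotation3 f A \<longleftrightarrow> (\<exists>a b c. distinct [a, b, c] \<and> A = {a, b, c} \<and> f = three_cycle a b c)"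

lemma rotation3_permutes:
  assumes "rotation3 f A"
  shows "f permutes A"
proof -
  obtain a b c where *: "distinct [a, b, c]" "A = {a, b, c}" "f = three_cycle a b c"
    using assms by (auto simp: rotation3_def)
  have "inj_on f A" "f ` A = A"
    using * by (auto simp: three_cycle_def inj_on_def)
  then have "bij_betw f A A" by (simp add: bij_betw_def)
  then show ?thesis
    by (rule bij_imp_permutes) (use * in \<open>auto simp: three_cycle_def\<close>)
qed

lemma rotation3_cyclic_on:
  assumes "rotation3 f A"
  shows "cyclic_on f A"
proof -
  obtain a b c where *: "distinct [a, b, c]" "A = {a, b, c}" "f = three_cycle a b c"
    using assms by (auto simp: rotation3_def)
  have f: "f a = b" "f b = c" "f c = a"
    using * by (auto simp: three_cycle_def)
  have "b \<in> orbit f a" using orbit.base[of f a] f by simp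
  then have "c \<in> orbit f a" using orbit.step[of b f a] f by simp
  then have "a \<in> orbit f a" using orbit.step[of c f a] f by simp
  have "x \<in> A" if "x \<in> orbit f a" for x
    using that by induction (use * f in auto)
  then have "A = orbit f a"
    using \<open>a \<in> orbit f a\<close> \<open>b \<in> orbit f a\<close> \<open>c \<in> orbit f a\<close> * by auto
  then show ?thesis using * by (auto simp: cyclic_on_def)
qed

lemma rotation3_exists:
  assumes "card A = 3"
  shows "\<exists>f. rotation3 f A"
  using assms by (auto simp: rotation3_def card_3_iff)

text \<open>In a 3-cycle each element has one of the other two as successor and the remaining one as
  predecessor. The second and third equivalences serve two walks crossing an edge in the same
  direction, the first one serves opposite directions.\<close>

lemma rotation3_turns:
  assumes "rotation3 f A" "x \<in> A" "y \<in> A" "z \<in> A" "x \<noteq> y" "y \<noteq> z" "x \<noteq> z"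
  shows "f x = y \<longleftrightarrow> f y = z" and "f x = y \<longleftrightarrow> f z \<noteq> y" and "f y = x \<longleftrightarrow> f y \<noteq> z"
  using assms by (auto simp: rotation3_def three_cycle_def)

text \<open>This makes every corner admissible for the facial walk rule: a step that does not go to
  the successor goes to the predecessor.\<close>

lemma rotation3_either:
  assumes "rotation3 f A" "x \<in> A" "y \<in> A" "x \<noteq> y"
  shows "f x = y \<or> f y = x"
  using assms by (auto simp: rotation3_def three_cycle_def)

text \<open>Turn \<open>i\<close> is the one from edge \<open>i - 1\<close> to edge \<open>i\<close>, with indices modulo the length \<open>n\<close> of the
  walk; turns \<open>0\<close> and \<open>n\<close> coincide.\<close>

definition turn :: "('a \<Rightarrow> 'a set \<Rightarrow> 'a set) \<Rightarrow> 'a walk \<Rightarrow> nat \<Rightarrow> bool" where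
  "turn \<pi> = (\<lambda>(vs, es) i.
     \<pi> (vs ! i) (es ! ((i + length es - 1) mod length es)) = es ! (i mod length es))"

text \<open>The side used along a walk is to be 1 at turns to the successor and -1 at all others.
  The signature of an edge is then the change of side across it.\<close>

definition matches_turns ::
    "('a \<Rightarrow> 'a set \<Rightarrow> 'a set) \<Rightarrow> ('a set \<Rightarrow> int) \<Rightarrow> 'a walk \<Rightarrow> bool" where
  "matches_turns \<pi> \<sigma> C \<longleftrightarrow> (\<forall>i<length (snd C).
     \<sigma> (snd C ! i) = (if turn \<pi> C i = turn \<pi> C (Suc i) then 1 else -1))"

section \<open>Walks of a partial CDC as facial walks, for an arbitrary rotation system\<close>

lemma distinct_if_count_list_le:
  "(\<And>x. x \<in> set xs \<Longrightarrow> count_list xs x \<le> 1) \<Longrightarrow> distinct xs"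
proof (induction xs)
  case (Cons y xs)
  have "y \<notin> set xs" using Cons.prems[of y] by (auto simp: count_list_0_iff)
  moreover have "distinct xs"
    using Cons by (metis count_list.simps(2) le_add1 le_trans list.set_intros(2))
  ultimately show ?case by simp
qed simp

text \<open>The rotation system is a parameter because two are plugged in: an arbitrary one for the
  existence statement, and the one that the program builds.\<close>

locale rotated_CDC =
  fixes V :: "'a set" and E :: "'a set set" and Cs :: "'a walk list"
    and \<pi> :: "'a \<Rightarrow> 'a set \<Rightarrow> 'a set"
  assumes edge: "e \<in> E \<Longrightarrow> e \<subseteq> V \<and> card e = 2"
    and rotation: "v \<in> V \<Longrightarrow> rotation3 (\<pi> v) (incident E v)"
    and CDC: "partial_CDC V E Cs"
begin

lemma closed: "C \<in> set Cs \<Longrightarrow> closed_walk E C"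
  using CDC by (auto simp: partial_CDC_def)

text \<open>By (C1) a walk using an edge twice would exhaust the total of two alone, whereas two
  different walks must contribute one each.\<close>

lemma distinct_edges:
  assumes "(vs, es) \<in> set Cs"
  shows "distinct es"
proof -
  obtain k where k: "k < length Cs" "Cs ! k = (vs, es)"
    using assms by (auto simp: in_set_conv_nth)
  have "count_list es e \<le> 1" if "e \<in> set es" for e
  proof -
    have "e \<in> E"
      using closed[OF assms] that by (auto simp: closed_walk_def in_set_conv_nth)
    let ?c = "\<lambda>i. times_covered (Cs ! i) e"
    have sum: "?c k + (\<Sum>i\<in>{..<length Cs} - {k}. ?c i) = (\<Sum>i<length Cs. ?c i)"
      using k by (simp add: sum.remove)
    have c: "?c k = count_list es e" using k by (simp add: times_covered_def)
    consider "(\<Sum>i<length Cs. ?c i) \<le> 1"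
      | i j where "(\<Sum>i<length Cs. ?c i) = 2" "i < length Cs" "j < length Cs" "i \<noteq> j"
          "?c i = 1" "?c j = 1"
      using CDC \<open>e \<in> E\<close> unfolding partial_CDC_def by blast
    then show ?thesis
    proof cases
      case 1
      then show ?thesis using sum c by linarith
    next
      case 2
      \<comment> \<open>One of the two covering walks is not walk \<open>k\<close>; it takes 1 from
        the total of 2.\<close>
      define i' where "i' = (if i = k then j else i)"
      have "i' \<in> {..<length Cs} - {k}" "?c i' = 1"
        using 2 by (auto simp: i'_def)
      then have "1 \<le> (\<Sum>i\<in>{..<length Cs} - {k}. ?c i)"
        using member_le_sum[of i' "{..<length Cs} - {k}" ?c] by simp
      then show ?thesis using sum c 2 by linarith
    qed
  qed
  then show ?thesis
    by (rule distinct_if_count_list_le)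
qed

lemma corner:
  assumes "(vs, es) \<in> set Cs" "i \<le> length es"
  defines "a \<equiv> es ! ((i + length es - 1) mod length es)" and "e \<equiv> es ! (i mod length es)"
  shows "vs ! i \<in> V" "a \<in> incident E (vs ! i)" "e \<in> incident E (vs ! i)" "a \<noteq> e"
    "a \<in> set es" "e \<in> set es"
proof -
  let ?n = "length es"
  have c: "?n \<ge> 1" "length vs = ?n + 1" "vs ! 0 = vs ! ?n"
    and es: "\<And>j. j < ?n \<Longrightarrow> es ! j \<in> E \<and> es ! j = {vs ! j, vs ! (j + 1)}"
    using closed[OF assms(1)] by (auto simp: closed_walk_def)
  have "?n \<noteq> 1"
  proof
    assume "?n = 1"
    then have "es ! 0 = {vs ! 0}" "es ! 0 \<in> E" using es[of 0] c by auto
    then show False using edge by fastforce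
  qed
  then have n: "?n \<ge> 2" using c by linarith
  obtain p q where pq: "p < ?n" "q < ?n" "p \<noteq> q" "a = es ! p" "e = es ! q"
    "vs ! i = vs ! Suc p" "vs ! i = vs ! q"
  proof (cases "0 < i \<and> i < ?n")
    case True
    then have "(i + ?n - 1) mod ?n = i - 1"
      using mod_add_self2[of "i - 1" ?n] by auto
    then show ?thesis using True by (intro that[of "i - 1" i]) (auto simp: a_def e_def)
  next
    case False
    then have i: "i = 0 \<or> i = ?n" using assms(2) by auto
    then have "(i + ?n - 1) mod ?n = ?n - 1"
      using c(1) mod_add_self2[of "?n - 1" ?n] by auto
    then have "a = es ! (?n - 1)" by (simp add: a_def)
    moreover have "i mod ?n = 0" using i by auto
    then have "e = es ! 0" by (simp add: e_def)
    moreover have "vs ! i = vs ! ?n" "vs ! i = vs ! 0" using c(3) i by auto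
    ultimately show ?thesis
      using n c(1) Suc_diff_le[of 1 ?n] by (intro that[of "?n - 1" 0]) auto
  qed
  then have "a \<noteq> e"
    using distinct_edges[OF assms(1)] by (simp add: nth_eq_iff_index_eq)
  then have "a \<in> E \<and> vs ! i \<in> a \<and> e \<in> E \<and> vs ! i \<in> e \<and> a \<noteq> e \<and> a \<in> set es \<and> e \<in> set es"
    using es[OF pq(1)] es[OF pq(2)] pq nth_mem[of p es] nth_mem[of q es] by fastforce
  then show "vs ! i \<in> V" "a \<in> incident E (vs ! i)" "e \<in> incident E (vs ! i)" "a \<noteq> e"
    "a \<in> set es" "e \<in> set es"
    using edge[of a] by (auto simp: incident_def)
qed

text \<open>Distinct two-element edges through \<open>v\<close> meet in \<open>v\<close> only, so
  (C2) applies to them.\<close>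

lemma corner_in_one_walk:
  assumes "i < length Cs" "j < length Cs" "i \<noteq> j" "v \<in> V"
    and "e \<in> incident E v" "f \<in> incident E v" "e \<noteq> f"
    and "{e, f} \<subseteq> set (snd (Cs ! i))" "{e, f} \<subseteq> set (snd (Cs ! j))"
  shows False
proof -
  have ef: "e \<in> E" "f \<in> E" "v \<in> e" "v \<in> f" using assms by (auto simp: incident_def)
  then have "card e = 2" "card f = 2" using edge by auto
  then obtain x y where "e = {v, x}" "f = {v, y}"
    using ef by (auto simp: card_2_iff)
  then have "e \<inter> f = {v}" using assms(7) by auto
  then have "card {i. i < length Cs \<and> {e, f} \<subseteq> set (snd (Cs ! i))} \<le> 1"
    using CDC ef assms(4) unfolding partial_CDC_def by blast
  moreover have "card {i, j} \<le> card {i. i < length Cs \<and> {e, f} \<subseteq> set (snd (Cs ! i))}"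
    by (rule card_mono) (use assms in auto)
  ultimately show False using assms(3) by simp
qed

text \<open>At each end of the shared edge the two walks use the two different remaining edges. With
  the same direction, exactly one of these precedes the shared edge (and one follows it), so both
  turns flip. With opposite directions, one walk enters the edge where the other leaves it, and the
  turns are equal crosswise. Either way, equality of the two turns is preserved.\<close>

lemma turns_agree:
  assumes "k < length Cs" "Cs ! k = (vs, es)" "i < length es"
    and "l < length Cs" "Cs ! l = (ws, fs)" "j < length fs"
    and "es ! i = fs ! j"
  shows "(turn \<pi> (vs, es) i = turn \<pi> (vs, es) (Suc i)) =
    (turn \<pi> (ws, fs) j = turn \<pi> (ws, fs) (Suc j))"
proof (cases "k = l")
  case True
  have "(vs, es) \<in> set Cs" using assms nth_mem by metis
  then have "i = j"
    using True assms distinct_edges[of vs es] by (auto simp: nth_eq_iff_index_eq)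
  then show ?thesis using True assms by simp
next
  case False
  have C: "(vs, es) \<in> set Cs" and D: "(ws, fs) \<in> set Cs"
    using assms nth_mem by metis+
  define a c where "a = es ! ((i + length es - 1) mod length es)"
    and "c = es ! (Suc i mod length es)"
  define a' c' where "a' = fs ! ((j + length fs - 1) mod length fs)"
    and "c' = fs ! (Suc j mod length fs)"
  define e where "e = es ! i"
  have e: "e = fs ! j" using assms by (simp add: e_def)
  have ends: "e = {vs ! i, vs ! Suc i}" "e = {ws ! j, ws ! Suc j}" "e \<in> E"
    using closed[OF C] closed[OF D] assms by (auto simp: closed_walk_def e_def)
  have u: "vs ! i \<in> V" "a \<in> incident E (vs ! i)" "e \<in> incident E (vs ! i)" "a \<noteq> e"
    "a \<in> set es" "e \<in> set es"
    using corner[OF C, of i] assms by (auto simp: a_def e_def)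
  have w: "vs ! Suc i \<in> V" "c \<in> incident E (vs ! Suc i)" "e \<in> incident E (vs ! Suc i)" "e \<noteq> c"
    "c \<in> set es"
    using corner[OF C, of "Suc i"] assms by (auto simp: c_def e_def)
  have u': "ws ! j \<in> V" "a' \<in> incident E (ws ! j)" "e \<in> incident E (ws ! j)" "a' \<noteq> e"
    "a' \<in> set fs" "e \<in> set fs"
    using corner[OF D, of j] assms by (auto simp: a'_def e)
  have w': "ws ! Suc j \<in> V" "c' \<in> incident E (ws ! Suc j)" "e \<in> incident E (ws ! Suc j)" "e \<noteq> c'"
    "c' \<in> set fs"
    using corner[OF D, of "Suc j"] assms by (auto simp: c'_def e)
  have turns: "turn \<pi> (vs, es) i \<longleftrightarrow> \<pi> (vs ! i) a = e"
    "turn \<pi> (vs, es) (Suc i) \<longleftrightarrow> \<pi> (vs ! Suc i) e = c"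
    "turn \<pi> (ws, fs) j \<longleftrightarrow> \<pi> (ws ! j) a' = e"
    "turn \<pi> (ws, fs) (Suc j) \<longleftrightarrow> \<pi> (ws ! Suc j) e = c'"
    using assms(3,6,7) by (simp_all add: turn_def a_def a'_def c_def c'_def e_def)
  \<comment> \<open>If \<open>x\<close> and \<open>y\<close> were equal, the corner formed by
    \<open>e\<close> and \<open>x\<close> at \<open>v\<close> would lie in both walks.\<close>
  have other: "x \<noteq> y"
    if "v \<in> V" "x \<in> incident E v" "e \<in> incident E v" "x \<noteq> e" "x \<in> set es" "y \<in> set fs" for v x y
    using corner_in_one_walk[of k l v e x] that assms(1,2,4,5) False u(6) u'(6) by auto
  have "{ws ! j, ws ! Suc j} = {vs ! i, vs ! Suc i}"
    by (simp only: ends(1)[symmetric] ends(2)[symmetric])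
  then consider "ws ! j = vs ! i" "ws ! Suc j = vs ! Suc i"
    | "ws ! j = vs ! Suc i" "ws ! Suc j = vs ! i"
    unfolding doubleton_eq_iff by blast
  then show ?thesis
  proof cases
    case 1
    have "a \<noteq> a'" "c \<noteq> c'"
      using other[OF u(1-5) u'(5)] other[OF w(1-3) w(4)[symmetric] w(5) w'(5)] by simp_all
    have "\<pi> (vs ! i) a = e \<longleftrightarrow> \<pi> (vs ! i) a' \<noteq> e"
      by (rule rotation3_turns(2)[OF rotation[OF u(1)]]) (use u u' \<open>a \<noteq> a'\<close> 1 in simp_all)
    moreover have "\<pi> (vs ! Suc i) e = c \<longleftrightarrow> \<pi> (vs ! Suc i) e \<noteq> c'"
      by (rule rotation3_turns(3)[OF rotation[OF w(1)]]) (use w w' \<open>c \<noteq> c'\<close> 1 in simp_all)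
    ultimately show ?thesis unfolding turns 1 by argo
  next
    case 2
    have "a \<noteq> c'" "c \<noteq> a'"
      using other[OF u(1-5) w'(5)] other[OF w(1-3) w(4)[symmetric] w(5) u'(5)] by simp_all
    have "\<pi> (vs ! i) a = e \<longleftrightarrow> \<pi> (vs ! i) e = c'"
      by (rule rotation3_turns(1)[OF rotation[OF u(1)]]) (use u w' \<open>a \<noteq> c'\<close> 2 in simp_all)
    moreover have "\<pi> (vs ! Suc i) a' = e \<longleftrightarrow> \<pi> (vs ! Suc i) e = c"
      by (rule rotation3_turns(1)[OF rotation[OF w(1)]]) (use w u' \<open>c \<noteq> a'\<close> 2 in simp_all)
    ultimately show ?thesis unfolding turns 2 by argo
  qed
qed

text \<open>An edge gets -1 if some walk through it demands this. By \<open>turns_agree\<close>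
  every walk through it then demands the same, and edges on no walk get 1.\<close>

lemma ex_signature:
  "\<exists>\<sigma>. (\<forall>e. \<sigma> e \<in> {-1, 1}) \<and> (\<forall>C\<in>set Cs. matches_turns \<pi> \<sigma> C)"
proof -
  define twisted where "twisted e \<longleftrightarrow> (\<exists>C\<in>set Cs. \<exists>i<length (snd C).
    snd C ! i = e \<and> turn \<pi> C i \<noteq> turn \<pi> C (Suc i))" for e
  have "twisted (snd C ! i) \<longleftrightarrow> turn \<pi> C i \<noteq> turn \<pi> C (Suc i)"
    if C: "C \<in> set Cs" "i < length (snd C)" for C i
  proof -
    have "(turn \<pi> C i = turn \<pi> C (Suc i)) = (turn \<pi> D j = turn \<pi> D (Suc j))"
      if D: "D \<in> set Cs" "j < length (snd D)" "snd D ! j = snd C ! i" for D j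
    proof -
      obtain k l where "k < length Cs" "l < length Cs" "Cs ! k = C" "Cs ! l = D"
        using C D by (auto simp: in_set_conv_nth)
      then show ?thesis
        using turns_agree[of k "fst C" "snd C" i l "fst D" "snd D" j] C D by simp
    qed
    then show ?thesis using C unfolding twisted_def by metis
  qed
  then show ?thesis
    by (intro exI[of _ "\<lambda>e. if twisted e then -1 else 1"]) (auto simp: matches_turns_def)
qed

text \<open>The initial side is read off turn 0. Multiplying by the signatures keeps side and turn
  in step, and the side returns to its initial value because the last turn is turn 0 again.\<close>

lemma facial_walk_if_matches_turns:
  assumes C: "C \<in> set Cs" and matches: "matches_turns \<pi> \<sigma> C"
  shows "facial_walk E \<pi> \<sigma> C"
proof -
  obtain vs es where Cdef: "C = (vs, es)" by (cases C)
  let ?n = "length es" and ?t = "turn \<pi> C"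
  define \<epsilon> :: int where "\<epsilon> = (if ?t 0 then 1 else -1)"
  have cw: "closed_walk E (vs, es)" using closed C Cdef by simp
  then have n: "?n \<ge> 1" "vs ! 0 = vs ! ?n" by (auto simp: closed_walk_def)
  have side: "side \<sigma> es \<epsilon> i = (if ?t i then 1 else -1)" if "i \<le> ?n" for i
    using that
  proof (induction i)
    case 0
    then show ?case by (simp add: side_def \<epsilon>_def)
  next
    case (Suc i)
    then have "side \<sigma> es \<epsilon> (Suc i) = side \<sigma> es \<epsilon> i * \<sigma> (es ! i)"
      by (simp add: side_def)
    also have "\<sigma> (es ! i) = (if ?t i = ?t (Suc i) then 1 else -1)"
      using matches Suc Cdef by (auto simp: matches_turns_def)
    finally show ?case using Suc by auto
  qed
  have "es ! (i mod ?n) = (if side \<sigma> es \<epsilon> i = 1 then \<pi> (vs ! i) (es ! (i - 1))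
              else inv (\<pi> (vs ! i)) (es ! (i - 1)))" if i: "i \<in> {1..?n}" for i
  proof -
    have prev: "(i + ?n - 1) mod ?n = i - 1"
      using i mod_add_self2[of "i - 1" ?n] by auto
    note c = corner[of vs es i, unfolded prev]
    have mem: "(vs, es) \<in> set Cs" using C Cdef by simp
    have rot: "rotation3 (\<pi> (vs ! i)) (incident E (vs ! i))"
      using rotation c(1)[OF mem] i by auto
    have "?t i \<longleftrightarrow> \<pi> (vs ! i) (es ! (i - 1)) = es ! (i mod ?n)"
      by (simp only: turn_def Cdef prod.case prev)
    moreover have "\<pi> (vs ! i) (es ! (i - 1)) = es ! (i mod ?n) \<or>
        \<pi> (vs ! i) (es ! (i mod ?n)) = es ! (i - 1)"
      by (rule rotation3_either[OF rot]) (use c[OF mem] i in simp_all)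
    moreover have "inj (\<pi> (vs ! i))"
      using rotation3_permutes[OF rot] by (rule permutes_inj)
    moreover have "side \<sigma> es \<epsilon> i = 1 \<longleftrightarrow> ?t i"
      using side[of i] i by simp
    ultimately show ?thesis
      using inv_f_eq[of "\<pi> (vs ! i)" "es ! (i mod ?n)" "es ! (i - 1)"] by presburger
  qed
  moreover have "side \<sigma> es \<epsilon> ?n = \<epsilon>"
  proof -
    have "(?n + ?n - 1) mod ?n = (0 + ?n - 1) mod ?n"
      using n(1) mod_add_self2[of "?n - 1" ?n] by simp
    then have "?t ?n \<longleftrightarrow> ?t 0"
      by (simp only: turn_def Cdef prod.case n(2) mod_self mod_0)
    then show ?thesis using side[of ?n] by (simp add: \<epsilon>_def)
  qed
  moreover have "es ! k \<noteq> es ! 0" if "0 < k \<and> k < ?n" for k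
    using that nth_eq_iff_index_eq[OF distinct_edges[of vs es], of k 0] C Cdef by force
  moreover have "\<epsilon> \<in> {-1, 1}" by (simp add: \<epsilon>_def)
  ultimately show ?thesis
    using cw unfolding facial_walk_def Cdef by blast
qed

text \<open>Shifts and reversals keep the set of edges, so two equal walks would share a corner,
  against (C2).\<close>

lemma different_walks:
  assumes "i < length Cs" "j < length Cs" "i \<noteq> j"
  shows "\<not> same_walk (Cs ! i) (Cs ! j)"
proof
  assume "same_walk (Cs ! i) (Cs ! j)"
  moreover obtain vs es where C: "Cs ! i = (vs, es)" by (cases "Cs ! i")
  ultimately have "set (snd (Cs ! j)) = set es"
    by (auto simp: same_walk_def shift_walk_def reverse_walk_def Let_def)
  moreover have "(vs, es) \<in> set Cs" using C assms nth_mem by metis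
  ultimately show False
    using corner[of vs es 0]
      corner_in_one_walk[of i j "vs ! 0" "es ! (0 mod length es)"
        "es ! ((0 + length es - 1) mod length es)"]
      assms C by auto
qed

theorem some_facial_walks_if_matches_turns:
  assumes "\<forall>C\<in>set Cs. matches_turns \<pi> \<sigma> C"
  shows "some_facial_walks E \<pi> \<sigma> Cs"
  using assms facial_walk_if_matches_turns different_walks by (auto simp: some_facial_walks_def)

lemma embedding:
  assumes "\<forall>e\<in>E. \<sigma> e \<in> {-1, 1}"
  shows "embedding V E \<pi> \<sigma>"
  unfolding embedding_def
  using assms rotation3_permutes[OF rotation] rotation3_cyclic_on[OF rotation] by blast

end

lemma ex_embedding:
  assumes "simple_graph V E" "cubic V E" "partial_CDC V E Cs"
  shows "\<exists>\<pi> \<sigma>. embedding V E \<pi> \<sigma> \<and> some_facial_walks E \<pi> \<sigma> Cs"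
proof -
  have "\<forall>v\<in>V. \<exists>f. rotation3 f (incident E v)"
    using assms(2) rotation3_exists by (auto simp: cubic_def)
  then obtain \<pi> where "\<forall>v\<in>V. rotation3 (\<pi> v) (incident E v)"
    by metis
  then interpret rotated_CDC V E Cs \<pi>
    using assms by unfold_locales (auto simp: simple_graph_def)
  show ?thesis
    using ex_signature some_facial_walks_if_matches_turns embedding by blast
qed

section \<open>Running times of programs\<close>

text \<open>Since \<open>exec\<close> derives only halting runs whose writes respect
  \<open>W\<close>, this combines termination, word length, running time and the
  postcondition.\<close>

definition achieves :: "nat \<Rightarrow> prog \<Rightarrow> nat \<Rightarrow> (state \<Rightarrow> bool) \<Rightarrow> state \<Rightarrow> bool" where
  "achieves W p T Q s \<longleftrightarrow> (\<exists>k s'. exec W p s k s' \<and> k \<le> T \<and> Q s')"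

lemma achieves_mono:
  "achieves W p T Q s \<Longrightarrow> T \<le> T' \<Longrightarrow> (\<And>s'. Q s' \<Longrightarrow> Q' s') \<Longrightarrow> achieves W p T' Q' s"
  unfolding achieves_def by (meson le_trans)

lemma achieves_Seq:
  assumes "achieves W p T R s" and "\<And>s'. R s' \<Longrightarrow> achieves W q T' Q s'"
  shows "achieves W (Seq p q) (T + T') Q s"
  using assms unfolding achieves_def by (meson add_mono exec.Seq)

text \<open>The invariant is indexed by the number of completed rounds, which is known in advance
  for all loops used here. Each round pays 1 for its test, and the final failing test pays 1
  more.\<close>

lemma achieves_While:
  assumes "\<And>i s. i < N \<Longrightarrow> I i s \<Longrightarrow> cond_val c s"
    and "\<And>i s. i < N \<Longrightarrow> I i s \<Longrightarrow> achieves W p (T i) (I (Suc i)) s"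
    and "\<And>s. I N s \<Longrightarrow> \<not> cond_val c s"
    and "I 0 s"
  shows "achieves W (While c p) ((\<Sum>i<N. T i + 1) + 1) (I N) s"
proof -
  have "achieves W (While c p) ((\<Sum>i\<in>{j..<N}. T i + 1) + 1) (I N) s" if "j \<le> N" "I j s" for j s
    using that
  proof (induction "N - j" arbitrary: j s)
    case 0
    then have "j = N" by simp
    then have "exec W (While c p) s 1 s" using 0 assms(3) exec.WhileFalse by metis
    then show ?case using 0 \<open>j = N\<close> unfolding achieves_def by (intro exI[of _ 1] exI[of _ s]) simp
  next
    case (Suc d)
    then have j: "j < N" by simp
    obtain k s' where body: "exec W p s k s'" "k \<le> T j" "I (Suc j) s'"
      using assms(2)[OF j Suc.prems(2)] by (auto simp: achieves_def)
    have "achieves W (While c p) ((\<Sum>i\<in>{Suc j..<N}. T i + 1) + 1) (I N) s'"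
      by (rule Suc.hyps(1)) (use Suc.hyps(2) body(3) j in simp_all)
    then obtain l s'' where rest: "exec W (While c p) s' l s''"
      "l \<le> (\<Sum>i\<in>{Suc j..<N}. T i + 1) + 1" "I N s''"
      unfolding achieves_def by blast
    have "exec W (While c p) s (1 + k + l) s''"
      using exec.WhileTrue[OF assms(1)[OF j Suc.prems(2)] body(1) rest(1)] .
    moreover have "(\<Sum>i\<in>{j..<N}. T i + 1) = (T j + 1) + (\<Sum>i\<in>{Suc j..<N}. T i + 1)"
      using j by (rule sum.atLeast_Suc_lessThan)
    ultimately show ?case
      using body(2) rest(2,3) unfolding achieves_def
      by (intro exI[of _ "1 + k + l"] exI[of _ s'']) simp
  qed
  from this[of 0 s] assms(4) show ?thesis by (simp add: atLeast0LessThan)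
qed

text \<open>\<open>wp\<close> and \<open>cost\<close> are meant for loop-free programs only; their values on loops are junk
  (harmless, as \<open>wp\<close> is then false).\<close>

fun wp :: "nat \<Rightarrow> prog \<Rightarrow> (state \<Rightarrow> bool) \<Rightarrow> state \<Rightarrow> bool" where
  "wp W (Assign r a) Q s \<longleftrightarrow> expr_val a s \<le> W \<and> Q ((fst s)(r := expr_val a s), snd s)"
| "wp W (Store a b) Q s \<longleftrightarrow> expr_val a s \<le> W \<and> expr_val b s \<le> W \<and>
     Q (fst s, (snd s)(expr_val a s := expr_val b s))"
| "wp W (Seq p q) Q s \<longleftrightarrow> wp W p (wp W q Q) s"
| "wp W (IfElse c p q) Q s \<longleftrightarrow> (if cond_val c s then wp W p Q s else wp W q Q s)"
| "wp W (While c p) Q s \<longleftrightarrow> False"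

fun cost :: "prog \<Rightarrow> nat" where
  "cost (Assign r a) = 1"
| "cost (Store a b) = 1"
| "cost (Seq p q) = cost p + cost q"
| "cost (IfElse c p q) = 1 + (cost p + cost q)"
| "cost (While c p) = 0"

text \<open>At a conditional \<open>cost\<close> charges for both branches; it is an upper bound
  that does not depend on the state.\<close>

lemma achieves_wp: "wp W p Q s \<Longrightarrow> achieves W p (cost p) Q s"
proof (induction p arbitrary: Q s)
  case (Assign r a)
  then show ?case using exec.Assign[of a s W r] by (auto simp: achieves_def)
next
  case (Store a b)
  then show ?case using exec.Store[of a s W b] by (auto simp: achieves_def)
next
  case (Seq p q)
  then have "achieves W p (cost p) (wp W q Q) s" by simp
  then show ?case using achieves_Seq Seq.IH(2) by (metis cost.simps(3))
next
  case (IfElse c p q)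
  show ?case
  proof (cases "cond_val c s")
    case True
    then obtain k s' where "exec W p s k s'" "k \<le> cost p" "Q s'"
      using IfElse.IH(1)[of Q s] IfElse.prems by (auto simp: achieves_def)
    then show ?thesis using exec.IfTrue[OF True, of W p k s' q]
      unfolding achieves_def by (intro exI[of _ "1 + k"] exI[of _ s']) simp
  next
    case False
    then obtain k s' where "exec W q s k s'" "k \<le> cost q" "Q s'"
      using IfElse.IH(2)[of Q s] IfElse.prems by (auto simp: achieves_def)
    then show ?thesis using exec.IfFalse[OF False, of W q k s' p]
      unfolding achieves_def by (intro exI[of _ "1 + k"] exI[of _ s']) simp
  qed
qed simp


lemma achieves_if_wp: "wp W p Q s \<Longrightarrow> cost p \<le> T \<Longrightarrow> achieves W p T Q s"
  using achieves_mono[OF achieves_wp] by blast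

section \<open>The program\<close>

text \<open>Vertex \<open>x\<close> owns three cells at offset \<open>3 * x\<close>, a product
  written as a sum for the machine. The cells are moved from the highest down so that none is
  overwritten before it has been copied. Register 3 holds the pushed edge, register 4 is
  scratch.\<close>

definition push :: "expr \<Rightarrow> prog" where
  "push x = Seq (Assign 4 (Add (Reg 0) (Add x (Add x x))))
     (Seq (Store (Add (Reg 4) (Const 2)) (Mem (Add (Reg 4) (Const 1))))
     (Seq (Store (Add (Reg 4) (Const 1)) (Mem (Reg 4)))
       (Store (Reg 4) (Reg 3))))"

text \<open>Three cells hold the most recent entries of a stack: pushing \<open>i\<close> shifts them by one.\<close>

definition push_mem :: "nat \<Rightarrow> nat \<Rightarrow> (nat \<Rightarrow> nat) \<Rightarrow> nat \<Rightarrow> nat" where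
  "push_mem b i h = h(b + 2 := h (b + 1), b + 1 := h b, b := i)"

lemma wp_push:
  assumes "b = fst s 0 + 3 * expr_val x s" "b + 2 \<le> W"
    and "snd s b \<le> W" "snd s (b + 1) \<le> W" "fst s 3 \<le> W"
    and "Q ((fst s)(4 := b), push_mem b (fst s 3) (snd s))"
  shows "wp W (push x) Q s"
proof -
  have b: "fst s 0 + (expr_val x s + (expr_val x s + expr_val x s)) = b"
    using assms(1) by simp
  show ?thesis
    using assms(2-) by (simp add: push_def b push_mem_def)
qed

text \<open>Decides whether edge \<open>e\<close> succeeds edge \<open>a\<close> at
  \<open>v\<close>. An edge \<open>a\<close> found in neither of the first two cells must be in the
  third, whose successor is in the first. Register \<open>r\<close> holds the address of the cells
  until the answer replaces it.\<close>

definition turn_prog :: "nat \<Rightarrow> expr \<Rightarrow> nat \<Rightarrow> nat \<Rightarrow> prog" where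
  "turn_prog r v a e =
     (let test = (\<lambda>x. IfElse (Equal (Mem x) (Reg e)) (Assign r (Const 1)) (Assign r (Const 0)))
      in Seq (Assign r (Add (Reg 0) (Add v (Add v v))))
        (IfElse (Equal (Mem (Reg r)) (Reg a)) (test (Add (Reg r) (Const 1)))
        (IfElse (Equal (Mem (Add (Reg r) (Const 1))) (Reg a)) (test (Add (Reg r) (Const 2)))
          (test (Reg r)))))"

lemma three_cycle_cases:
  "x \<in> {a, b, c} \<Longrightarrow> x = a \<and> three_cycle a b c x = b \<or>
    x \<noteq> a \<and> x = b \<and> three_cycle a b c x = c \<or>
    x \<noteq> a \<and> x \<noteq> b \<and> three_cycle a b c x = a"
  by (auto simp: three_cycle_def)

lemma wp_turn_prog:
  assumes "b = fst s 0 + 3 * expr_val v s" "b \<le> W" "1 \<le> W" "r \<noteq> a" "r \<noteq> e"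
    and "fst s a \<in> {snd s b, snd s (b + 1), snd s (b + 2)}"
    and "Q ((fst s)(r := of_bool
      (three_cycle (snd s b) (snd s (b + 1)) (snd s (b + 2)) (fst s a) = fst s e)), snd s)"
  shows "wp W (turn_prog r v a e) Q s"
proof -
  have b: "fst s 0 + (expr_val v s + (expr_val v s + expr_val v s)) = b"
    using assms(1) by simp
  let ?c = "three_cycle (snd s b) (snd s (b + 1)) (snd s (b + 2)) (fst s a)"
  consider "fst s a = snd s b" "?c = snd s (b + 1)"
    | "fst s a \<noteq> snd s b" "fst s a = snd s (b + 1)" "?c = snd s (b + 2)"
    | "fst s a \<noteq> snd s b" "fst s a \<noteq> snd s (b + 1)" "?c = snd s b"
    using three_cycle_cases[OF assms(6)] by blast
  then show ?thesis
    using assms(2-5,7) by cases (simp_all add: turn_prog_def b Let_def of_bool_def split: if_splits)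
qed

lemma cost_push: "cost (push x) = 4"
  by (simp add: push_def)

lemma cost_turn_prog: "cost (turn_prog r v a e) = 12"
  by (simp add: turn_prog_def Let_def)

text \<open>Register 0 ends up at the end of the input, which is where the output starts; registers 1 and 2
  hold the numbers of vertices and edges. Register 3 counts walks, then edges.\<close>

definition scan_prog :: prog where
  "scan_prog =
     Seq (Assign 1 (Mem (Const 0)))
     (Seq (Assign 2 (Mem (Const 1)))
     (Seq (Assign 0 (Add (Const 3) (Add (Reg 2) (Reg 2))))
     (Assign 3 (Mem (Add (Const 2) (Add (Reg 2) (Reg 2)))))))"

text \<open>The input does not state its own length, so its end is found by hopping over the walks.
  A walk of length l takes 2 l + 2 words: l itself, l + 1 vertices and l edges.\<close>

definition skip_walk_prog :: prog where
  "skip_walk_prog =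
     Seq (Assign 0 (Add (Reg 0) (Add (Const 2) (Add (Mem (Reg 0)) (Mem (Reg 0))))))
       (Assign 3 (Sub (Reg 3) (Const 1)))"

definition edge_prog :: prog where
  "edge_prog =
     Seq (push (Mem (Add (Const 2) (Add (Reg 3) (Reg 3)))))
     (Seq (push (Mem (Add (Const 3) (Add (Reg 3) (Reg 3)))))
       (Assign 3 (Add (Reg 3) (Const 1))))"

text \<open>Register 5 is the end of the current walk, and 6 the address of the first signature. Registers 7
  and 9 point to the current vertex and edge, 8 to the first edge of the walk. Registers 10, 11 and 12
  hold the previous, current and next edge, and 13 and 14 the turns at both ends of the current edge.\<close>

definition walk_init_prog :: prog where
  "walk_init_prog =
     Seq (Assign 7 (Add (Reg 5) (Const 1)))
     (Seq (Assign 8 (Add (Reg 7) (Add (Mem (Reg 5)) (Const 1))))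
     (Seq (Assign 9 (Reg 8))
     (Seq (Assign 5 (Add (Reg 8) (Mem (Reg 5))))
       (Assign 10 (Mem (Sub (Reg 5) (Const 1)))))))"

definition mark_prog :: prog where
  "mark_prog =
     Seq (IfElse (Equal (Reg 13) (Reg 14))
       (Store (Add (Reg 6) (Reg 11)) (Const 0)) (Store (Add (Reg 6) (Reg 11)) (Const 1)))
       (Assign 10 (Reg 11))"

definition turns_prog :: prog where
  "turns_prog =
     Seq (turn_prog 13 (Mem (Reg 7)) 10 11)
     (Seq (Assign 7 (Add (Reg 7) (Const 1)))
     (Seq (turn_prog 14 (Mem (Reg 7)) 11 12) mark_prog))"

text \<open>After the last edge of a walk the next edge is its first one, hence the
  conditional.\<close>

definition step_prog :: prog where
  "step_prog =
     Seq (Assign 11 (Mem (Reg 9)))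
     (Seq (Assign 9 (Add (Reg 9) (Const 1)))
     (Seq (IfElse (Less (Reg 9) (Reg 5)) (Assign 12 (Mem (Reg 9))) (Assign 12 (Mem (Reg 8))))
       turns_prog))"

definition embedding_prog :: prog where
  "embedding_prog =
     Seq scan_prog
     (Seq (While (Less (Const 0) (Reg 3)) skip_walk_prog)
     (Seq (Assign 3 (Const 0))
     (Seq (While (Less (Reg 3) (Reg 2)) edge_prog)
     (Seq (Seq (Assign 5 (Add (Const 3) (Add (Reg 2) (Reg 2))))
        (Assign 6 (Add (Reg 0) (Add (Reg 1) (Add (Reg 1) (Reg 1))))))
       (While (Less (Reg 5) (Reg 0))
         (Seq walk_init_prog (While (Less (Reg 9) (Reg 5)) step_prog)))))))"

lemma nth_concat_sum:
  "i < length xss \<Longrightarrow> j < length (xss ! i) \<Longrightarrow>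
    concat xss ! ((\<Sum>k<i. length (xss ! k)) + j) = xss ! i ! j"
proof (induction xss arbitrary: i)
  case (Cons ys xss)
  then show ?case
    by (cases i) (auto simp: nth_append sum.lessThan_Suc_shift simp del: sum.lessThan_Suc)
qed simp

section \<open>Correctness of the program\<close>

locale embedding_instance =
  fixes n :: nat and es :: "(nat \<times> nat) list" and ws :: "(nat list \<times> nat list) list"
  assumes inst: "(n, es, ws) \<in> bridgeless_cubic_instances"
begin

section \<open>Layout and size of the encoded instance\<close>

abbreviation m where "m \<equiv> length es"
abbreviation E where "E \<equiv> edges_of es"
abbreviation Cs where "Cs \<equiv> walks_of es ws"
abbreviation xs where "xs \<equiv> encode_instance (n, es, ws)"
abbreviation L where "L \<equiv> length xs"
abbreviation W where "W \<equiv> 100 * (L + 1)"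
abbreviation verts where "verts k \<equiv> fst (ws ! k)"
abbreviation inds where "inds k \<equiv> snd (ws ! k)"
abbreviation len where "len k \<equiv> length (inds k)"

text \<open>Address of the block of walk \<open>k\<close>. The 3 counts the numbers of vertices,
  edges and walks.\<close>

definition addr :: "nat \<Rightarrow> nat" where
  "addr k = 3 + 2 * m + (\<Sum>i<k. 2 * len i + 2)"

lemma inj: "inj_on (edge_at es) {..<m}"
  and graph: "simple_graph {..<n} E"
  and cubic: "cubic {..<n} E"
  and CDC: "partial_CDC {..<n} E Cs"
  and inds: "k < length ws \<Longrightarrow> i < len k \<Longrightarrow> inds k ! i < m"
  using inst nth_mem by (fastforce simp: bridgeless_cubic_instances_def)+

lemma walk_nth: "k < length ws \<Longrightarrow> Cs ! k = (verts k, map (edge_at es) (inds k))"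
  by (simp add: walks_of_def split_beta)

lemma length_Cs: "length Cs = length ws"
  by (simp add: walks_of_def)

lemma closed_nth: "k < length ws \<Longrightarrow> closed_walk E (Cs ! k)"
  using CDC length_Cs nth_mem unfolding partial_CDC_def by metis

lemma
  assumes "k < length ws"
  shows length_verts: "length (verts k) = len k + 1"
    and len_pos: "len k \<ge> 1"
  using closed_nth[OF assms] walk_nth[OF assms] by (auto simp: closed_walk_def)

lemma endpoints:
  assumes "i < m"
  shows "fst (es ! i) < n" "snd (es ! i) < n" "fst (es ! i) \<noteq> snd (es ! i)"
proof -
  have "edge_at es i \<in> E" using assms by (auto simp: edges_of_def)
  then have "edge_at es i \<subseteq> {..<n}" "card (edge_at es i) = 2"
    using graph by (auto simp: simple_graph_def)
  then show "fst (es ! i) < n" "snd (es ! i) < n" "fst (es ! i) \<noteq> snd (es ! i)"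
    by (auto simp: edge_at_def)
qed

lemma verts_less:
  assumes k: "k < length ws" and "j \<le> len k"
  shows "verts k ! j < n"
proof -
  obtain i where i: "i < len k" "j = i \<or> j = i + 1"
    using assms(2) len_pos[OF k] that[of j] that[of "j - 1"] by (cases "j = len k") auto
  then have "edge_at es (inds k ! i) = {verts k ! i, verts k ! (i + 1)}" "edge_at es (inds k ! i) \<in> E"
    using closed_nth[OF k] walk_nth[OF k] by (auto simp: closed_walk_def)
  then show ?thesis using i(2) graph by (auto simp: simple_graph_def)
qed

text \<open>Degree three puts every vertex on an edge, and an edge has two ends. The input has
  length at least \<open>2 * m\<close>, so addresses of the form \<open>L + 3 * n + i\<close>
  respect the linear word bound.\<close>

lemma n_le: "n \<le> 2 * m"
proof -
  have "\<exists>e\<in>E. v \<in> e" if "v < n" for v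
  proof -
    have "card (incident E v) = 3" using that cubic by (simp add: cubic_def)
    then have "incident E v \<noteq> {}" by auto
    then show ?thesis by (auto simp: incident_def)
  qed
  then have "{..<n} \<subseteq> (\<Union>i<m. edge_at es i)"
    by (fastforce simp: edges_of_def)
  then have "n \<le> card (\<Union>i<m. edge_at es i)"
    using card_mono[of "\<Union>i<m. edge_at es i" "{..<n}"] by (simp add: edge_at_def)
  also have "\<dots> \<le> (\<Sum>i<m. card (edge_at es i))" by (rule card_UN_le) simp
  also have "\<dots> \<le> (\<Sum>i<m. 2)"
    by (intro sum_mono) (simp add: edge_at_def card_insert_if)
  finally show ?thesis by simp
qed

lemma input_split:
  "xs = [n, m] @ concat (map (\<lambda>(u, v). [u, v]) es) @ [length ws] @
    concat (map (\<lambda>(vs, is). length is # vs @ is) ws)"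
  by (simp add: encode_instance_def)

lemma length_edges: "length (concat (map (\<lambda>(u, v). [u, v]) es)) = 2 * m"
  by (induction es) auto

lemma input_header: "xs ! 0 = n" "xs ! 1 = m" "xs ! (2 + 2 * m) = length ws"
  using length_edges by (auto simp: input_split nth_append)

lemma input_edge:
  assumes "i < m"
  shows "xs ! (2 + 2 * i) = fst (es ! i)" "xs ! (3 + 2 * i) = snd (es ! i)"
proof -
  have *: "concat (map (\<lambda>(u, v). [u, v]) es) ! (2 * i + j) = [fst (es ! i), snd (es ! i)] ! j"
    if "j < 2" for j
    using nth_concat_sum[of i "map (\<lambda>(u, v). [u, v]) es" j] assms that
    by (simp add: split_beta mult_2)
  have xs: "xs ! (2 + (2 * i + j)) = [fst (es ! i), snd (es ! i)] ! j" if "j < 2" for j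
    using *[OF that] assms that length_edges by (simp add: input_split nth_append)
  show "xs ! (2 + 2 * i) = fst (es ! i)" "xs ! (3 + 2 * i) = snd (es ! i)"
    using xs[of 0] xs[of 1] by (simp_all add: numeral_3_eq_3)
qed

lemma length_walk: "k < length ws \<Longrightarrow>
    length (map (\<lambda>(vs, is). length is # vs @ is) ws ! k) = 2 * len k + 2"
  using length_verts by (simp add: split_beta)

lemma input_walk:
  assumes "k < length ws" "j < 2 * len k + 2"
  shows "xs ! (addr k + j) = (len k # verts k @ inds k) ! j"
proof -
  let ?c = "map (\<lambda>(vs, is). length is # vs @ is) ws"
  have "(\<Sum>i<k. length (?c ! i)) = (\<Sum>i<k. 2 * len i + 2)"
    using assms length_walk by (intro sum.cong) simp_all
  then have "concat ?c ! ((\<Sum>i<k. 2 * len i + 2) + j) = (len k # verts k @ inds k) ! j"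
    using nth_concat_sum[of k ?c j] assms length_walk[OF assms(1)] by (simp add: split_beta)
  then show ?thesis
    using length_edges by (simp add: input_split nth_append addr_def)
qed

lemma input_len: "k < length ws \<Longrightarrow> xs ! addr k = len k"
  using input_walk[of k 0] by simp

lemma input_vert: "k < length ws \<Longrightarrow> j \<le> len k \<Longrightarrow> xs ! (addr k + 1 + j) = verts k ! j"
  using input_walk[of k "1 + j"] length_verts[of k] by (simp add: nth_append)

lemma input_ind: "k < length ws \<Longrightarrow> j < len k \<Longrightarrow> xs ! (addr k + len k + 2 + j) = inds k ! j"
  using input_walk[of k "len k + 2 + j"] length_verts[of k] by (simp add: nth_append add.assoc)

lemma addr_0: "addr 0 = 3 + 2 * m"
  and addr_Suc: "addr (Suc k) = addr k + 2 * len k + 2"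
  by (simp_all add: addr_def)

text \<open>Skipping all walks thus leads to the first cell after the input, where the output is
  placed.\<close>

lemma addr_length: "addr (length ws) = L"
proof -
  have "length (concat (map (\<lambda>(vs, is). length is # vs @ is) ws)) = (\<Sum>i<length ws. 2 * len i + 2)"
    using length_walk by (simp add: length_concat sum_list_sum_nth atLeast0LessThan)
  then show ?thesis using length_edges by (simp add: input_split addr_def)
qed

lemma addr_mono: "j \<le> k \<Longrightarrow> addr j \<le> addr k"
  by (simp add: addr_def sum_mono2)

lemma addr_le: "k \<le> length ws \<Longrightarrow> addr k \<le> L"
  using addr_mono[of k "length ws"] addr_length by simp

lemma addr_Suc_le: "k < length ws \<Longrightarrow> addr k + 2 * len k + 2 \<le> L"
  using addr_le[of "Suc k"] addr_Suc by simp

lemma m_le: "3 + 2 * m \<le> L"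
  using addr_le[of 0] addr_0 by simp

lemma length_ws_le: "length ws \<le> L"
proof -
  have "k \<le> addr k" for k by (induction k) (auto simp: addr_Suc)
  from this[of "length ws"] show ?thesis by (simp add: addr_length)
qed

section \<open>The rotation system obtained by pushing edges\<close>

definition incident_inds :: "nat \<Rightarrow> nat \<Rightarrow> nat list" where
  "incident_inds i v = rev (filter (\<lambda>e. v \<in> edge_at es e) [0..<i])"

abbreviation slot :: "nat \<Rightarrow> nat \<Rightarrow> nat" where
  "slot v j \<equiv> incident_inds m v ! j"

abbreviation succ_ind :: "nat \<Rightarrow> nat \<Rightarrow> nat" where
  "succ_ind v \<equiv> three_cycle (slot v 0) (slot v 1) (slot v 2)"

text \<open>The cyclic order runs from the latest to the earliest edge at \<open>v\<close>, since
  pushing leaves the latest edge in the first cell.\<close>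

definition rot :: "nat \<Rightarrow> nat set \<Rightarrow> nat set" where
  "rot v = three_cycle (edge_at es (slot v 0)) (edge_at es (slot v 1)) (edge_at es (slot v 2))"

lemma set_incident_inds: "set (incident_inds m v) = {i. i < m \<and> v \<in> edge_at es i}"
  by (auto simp: incident_inds_def)

lemma incident_eq: "incident E v = edge_at es ` set (incident_inds m v)"
  by (auto simp: set_incident_inds incident_def edges_of_def)

lemma length_incident_inds:
  assumes "v < n"
  shows "length (incident_inds m v) = 3"
proof -
  have "inj_on (edge_at es) (set (incident_inds m v))"
    using inj by (rule inj_on_subset) (auto simp: set_incident_inds)
  then have "card (set (incident_inds m v)) = card (incident E v)"
    by (simp add: incident_eq card_image)
  also have "\<dots> = 3" using cubic assms by (simp add: cubic_def)
  finally show ?thesis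
    using distinct_card[of "incident_inds m v"] by (simp add: incident_inds_def)
qed

lemma slots:
  assumes "v < n"
  shows "incident_inds m v = [slot v 0, slot v 1, slot v 2]"
    and "distinct [slot v 0, slot v 1, slot v 2]"
    and "{slot v 0, slot v 1, slot v 2} = {i. i < m \<and> v \<in> edge_at es i}"
proof -
  have "length (incident_inds m v) = Suc (Suc (Suc 0))"
    using length_incident_inds[OF assms] by simp
  then show eq: "incident_inds m v = [slot v 0, slot v 1, slot v 2]"
    by (auto simp: length_Suc_conv numeral_2_eq_2)
  have "distinct (incident_inds m v)" by (simp add: incident_inds_def)
  then show "distinct [slot v 0, slot v 1, slot v 2]"
    using eq by metis
  have "set [slot v 0, slot v 1, slot v 2] = {i. i < m \<and> v \<in> edge_at es i}"
    using set_incident_inds eq by metis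
  then show "{slot v 0, slot v 1, slot v 2} = {i. i < m \<and> v \<in> edge_at es i}" by simp
qed

lemma slot_less: "v < n \<Longrightarrow> j < 3 \<Longrightarrow> slot v j < m"
  using length_incident_inds[of v] nth_mem[of j "incident_inds m v"] set_incident_inds[of v] by auto

lemma rotation3_rot:
  assumes "v < n"
  shows "rotation3 (rot v) (incident E v)"
proof -
  have "incident E v = edge_at es ` set [slot v 0, slot v 1, slot v 2]"
    using incident_eq slots(1)[OF assms] by metis
  then have eq: "incident E v = {edge_at es (slot v 0), edge_at es (slot v 1), edge_at es (slot v 2)}"
    by simp
  have "slot v 0 < m" "slot v 1 < m" "slot v 2 < m"
    using slot_less[OF assms] by simp_all
  then have distinct: "distinct [edge_at es (slot v 0), edge_at es (slot v 1), edge_at es (slot v 2)]"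
    using slots(2)[OF assms] inj by (simp add: inj_on_eq_iff)
  show ?thesis
    unfolding rotation3_def rot_def by (intro exI conjI) (rule distinct, rule eq, rule refl)
qed

text \<open>Edges occur once in \<open>es\<close>, so the program may compare positions where the
  rotation compares edges.\<close>

lemma rot_eq_iff:
  assumes "v < n" "i < m" "v \<in> edge_at es i" "j < m"
  shows "rot v (edge_at es i) = edge_at es j \<longleftrightarrow> succ_ind v i = j"
proof -
  have s: "slot v 0 < m" "slot v 1 < m" "slot v 2 < m"
    using slot_less[OF assms(1)] by simp_all
  have "i \<in> {slot v 0, slot v 1, slot v 2}" using slots(3)[OF assms(1)] assms by blast
  then show ?thesis
    using s assms(4) inj by (auto simp: rot_def three_cycle_def inj_on_eq_iff)
qed

end

sublocale embedding_instance \<subseteq> rotated_CDC "{..<n}" E Cs rot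
proof
  show "e \<subseteq> {..<n} \<and> card e = 2" if "e \<in> E" for e
    using that graph by (auto simp: simple_graph_def)
qed (use rotation3_rot CDC in auto)

context embedding_instance
begin

section \<open>Turns and signature bits in terms of edge positions\<close>

definition prev_ind :: "nat \<Rightarrow> nat \<Rightarrow> nat" where
  "prev_ind k j = inds k ! ((j + len k - 1) mod len k)"

text \<open>Translates a turn into the comparison made by \<open>turn_prog\<close>. The length is
  added before 1 is subtracted, so that the predecessor of position 0 is the last position.\<close>

lemma walk_corner:
  assumes "k < length ws" "j \<le> len k"
  shows "prev_ind k j < m" "inds k ! (j mod len k) < m"
    and "verts k ! j \<in> edge_at es (prev_ind k j)"
    and "turn rot (Cs ! k) j \<longleftrightarrow> succ_ind (verts k ! j) (prev_ind k j) = inds k ! (j mod len k)"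
proof -
  have l: "(j + len k - 1) mod len k < len k" "j mod len k < len k"
    using len_pos[OF assms(1)] by (auto intro!: mod_less_divisor simp del: length_greater_0_conv)
  then show p: "prev_ind k j < m" "inds k ! (j mod len k) < m"
    using inds[OF assms(1)] by (simp_all add: prev_ind_def)
  have "Cs ! k \<in> set Cs" using assms(1) length_Cs by simp
  then have "(verts k, map (edge_at es) (inds k)) \<in> set Cs"
    using walk_nth[OF assms(1)] by simp
  from corner(2)[OF this, of j] assms(2) l(1) show v: "verts k ! j \<in> edge_at es (prev_ind k j)"
    by (simp add: incident_def prev_ind_def)
  have "turn rot (Cs ! k) j \<longleftrightarrow>
      rot (verts k ! j) (edge_at es (prev_ind k j)) = edge_at es (inds k ! (j mod len k))"
    using l by (simp add: walk_nth[OF assms(1)] turn_def prev_ind_def)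
  then show "turn rot (Cs ! k) j \<longleftrightarrow>
      succ_ind (verts k ! j) (prev_ind k j) = inds k ! (j mod len k)"
    using rot_eq_iff[OF verts_less[OF assms] p(1) v p(2)] by simp
qed

definition twist :: "nat \<Rightarrow> nat \<Rightarrow> nat" where
  "twist k j = of_bool (turn rot (Cs ! k) j \<noteq> turn rot (Cs ! k) (Suc j))"

text \<open>Following a second walk through an edge rewrites the bit that is already stored
  there.\<close>

lemma twist_unique:
  assumes "k < length ws" "i < len k" "l < length ws" "j < len l" "inds k ! i = inds l ! j"
  shows "twist k i = twist l j"
  using turns_agree[of k "verts k" "map (edge_at es) (inds k)" i l "verts l" "map (edge_at es) (inds l)" j]
    assms walk_nth length_Cs by (simp add: twist_def)

text \<open>Reduces correctness to the words of the output, from which the signature is decoded.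
  Bits of edges on no walk need only be 0 or 1, as no turn constrains them.\<close>

lemma embedding_solution:
  assumes "length ys = 3 * n + m"
    and slot: "\<And>v j. v < n \<Longrightarrow> j < 3 \<Longrightarrow> ys ! (3 * v + j) = slot v j"
    and bit: "\<And>i. i < m \<Longrightarrow> ys ! (3 * n + i) \<in> {0, 1}"
    and twist: "\<And>k j. k < length ws \<Longrightarrow> j < len k \<Longrightarrow> ys ! (3 * n + inds k ! j) = twist k j"
  shows "embedding_solution (n, es, ws) ys"
proof -
  define \<sigma> :: "nat set \<Rightarrow> int" where
    "\<sigma> e = (if ys ! (3 * n + inv_into {..<m} (edge_at es) e) = 0 then 1 else -1)" for e
  have \<sigma>: "\<sigma> (edge_at es i) = (if ys ! (3 * n + i) = 0 then 1 else -1)" if "i < m" for i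
    using that inj by (simp add: \<sigma>_def inv_into_f_f)
  have "matches_turns rot \<sigma> (Cs ! k)" if k: "k < length ws" for k
    using k inds[OF k] \<sigma> twist[OF k]
    by (auto simp: matches_turns_def walk_nth twist_def)
  then have "\<forall>C\<in>set Cs. matches_turns rot \<sigma> C"
    by (metis in_set_conv_nth length_Cs)
  then have "some_facial_walks E rot \<sigma> Cs"
    by (rule some_facial_walks_if_matches_turns)
  moreover have "embedding {..<n} E rot \<sigma>"
    by (rule embedding) (simp add: \<sigma>_def)
  moreover have "encodes_embedding n es rot \<sigma> ys"
  proof -
    have "(\<forall>j<3. ys ! (3 * v + j) < m) \<and>
        edge_at es ` {ys ! (3 * v + j) | j. j < 3} = incident E v \<and>
        (\<forall>j<3. rot v (edge_at es (ys ! (3 * v + j))) =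
                 edge_at es (ys ! (3 * v + (j + 1) mod 3)))" if v: "v < n" for v
    proof (intro conjI allI impI)
      show "ys ! (3 * v + j) < m" if "j < 3" for j
        using slot slot_less v that by simp
      have "{ys ! (3 * v + j) | j. j < 3} = set (incident_inds m v)"
        using slot[OF v] length_incident_inds[OF v] by (auto simp: set_conv_nth) metis
      then show "edge_at es ` {ys ! (3 * v + j) | j. j < 3} = incident E v"
        by (simp add: incident_eq)
      show "rot v (edge_at es (ys ! (3 * v + j))) = edge_at es (ys ! (3 * v + (j + 1) mod 3))"
        if "j < 3" for j
      proof -
        have s: "slot v j < m" "slot v ((j + 1) mod 3) < m"
          using slot_less[OF v] that by simp_all
        have "slot v j \<in> set (incident_inds m v)"
          using length_incident_inds[OF v] that by simp
        then have "v \<in> edge_at es (slot v j)" by (simp add: set_incident_inds)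
        moreover have "j = 0 \<or> j = 1 \<or> j = 2" using that by auto
        then have "succ_ind v (slot v j) = slot v ((j + 1) mod 3)"
          using slots(2)[OF v] by (auto simp: three_cycle_def numeral_2_eq_2)
        ultimately show ?thesis
          using rot_eq_iff[OF v s(1) _ s(2)] slot[OF v that] slot[OF v, of "(j + 1) mod 3"] by simp
      qed
    qed
    moreover have "ys ! (3 * n + i) = (if \<sigma> (edge_at es i) = 1 then 0 else 1)" if "i < m" for i
      using \<sigma>[OF that] bit[OF that] by auto
    ultimately show ?thesis
      using assms(1) unfolding encodes_embedding_def by blast
  qed
  ultimately show ?thesis by (auto simp: embedding_solution_def)
qed

section \<open>Invariants of the three phases: scanning the input, filling the slots, following the
  walks\<close>

definition has_input :: "(nat \<Rightarrow> nat) \<Rightarrow> bool" where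
  "has_input h \<longleftrightarrow> (\<forall>a<L. h a = xs ! a)"

definition has_slots :: "(nat \<Rightarrow> nat list) \<Rightarrow> (nat \<Rightarrow> nat) \<Rightarrow> bool" where
  "has_slots S h \<longleftrightarrow> (\<forall>v<n. \<forall>j<3. h (L + 3 * v + j) = S v ! j)"

lemma has_slots_push:
  assumes "has_slots S h" "x < n"
  shows "has_slots (S(x := i # S x)) (push_mem (L + 3 * x) i h)"
  unfolding has_slots_def
proof (intro allI impI)
  fix v j :: nat
  assume v: "v < n" and j: "j < 3"
  show "push_mem (L + 3 * x) i h (L + 3 * v + j) = (S(x := i # S x)) v ! j"
  proof (cases "v = x")
    case True
    have "h (L + 3 * x) = S x ! 0" "h (L + 3 * x + 1) = S x ! 1"
      using assms(1)[unfolded has_slots_def, rule_format, OF assms(2), of 0]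
        assms(1)[unfolded has_slots_def, rule_format, OF assms(2), of 1] by simp_all
    moreover have "j = 0 \<or> j = 1 \<or> j = 2" using j by auto
    ultimately show ?thesis using True by (auto simp: push_mem_def numeral_2_eq_2)
  next
    case False
    then have "L + 3 * v + j \<noteq> L + 3 * x" "L + 3 * v + j \<noteq> L + 3 * x + 1"
      "L + 3 * v + j \<noteq> L + 3 * x + 2"
      using j by presburger+
    then show ?thesis
      using assms(1)[unfolded has_slots_def, rule_format, OF v j] False by (simp add: push_mem_def)
  qed
qed

lemma has_input_push: "has_input h \<Longrightarrow> has_input (push_mem (L + b) i h)"
  by (auto simp: has_input_def push_mem_def)

text \<open>Until all edges are pushed a vertex may have fewer than three entries; the padding
  describes the zeros still in its cells.\<close>

definition slot_list :: "nat \<Rightarrow> nat \<Rightarrow> nat list" where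
  "slot_list i v = incident_inds i v @ [0, 0, 0]"

lemma slot_list_Suc:
  assumes "i < m"
  shows "slot_list (Suc i) = (let S = (slot_list i)(fst (es ! i) := i # slot_list i (fst (es ! i)))
    in S(snd (es ! i) := i # S (snd (es ! i))))"
  using endpoints(3)[OF assms]
  by (auto simp: slot_list_def incident_inds_def edge_at_def Let_def fun_eq_iff)

lemma slot_list_less: "i \<le> m \<Longrightarrow> j < 3 \<Longrightarrow> slot_list i v ! j \<le> m"
proof -
  assume "i \<le> m" "j < 3"
  then have "slot_list i v ! j \<in> set (slot_list i v)" by (intro nth_mem) (simp add: slot_list_def)
  then show ?thesis using \<open>i \<le> m\<close> by (auto simp: slot_list_def incident_inds_def)
qed

lemma slot_list_m: "v < n \<Longrightarrow> j < 3 \<Longrightarrow> slot_list m v ! j = slot v j"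
  using length_incident_inds by (simp add: slot_list_def nth_append)

definition frame :: "state \<Rightarrow> bool" where
  "frame s \<longleftrightarrow> fst s 0 = L \<and> fst s 1 = n \<and> fst s 2 = m \<and> has_input (snd s)"

lemma frame_read: "frame s \<Longrightarrow> a < L \<Longrightarrow> snd s a = xs ! a"
  by (simp add: frame_def has_input_def)

definition scan_inv :: "nat \<Rightarrow> state \<Rightarrow> bool" where
  "scan_inv k s \<longleftrightarrow> fst s 0 = addr k \<and> fst s 1 = n \<and> fst s 2 = m \<and> fst s 3 = length ws - k \<and>
     has_input (snd s) \<and> (\<forall>a\<ge>L. snd s a = 0)"

lemma L_ge: "3 \<le> L" "m \<le> L" "n \<le> L"
  using m_le n_le by linarith+

lemma scan_init: "achieves W scan_prog 4 (scan_inv 0) (initial_state xs)"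
proof (rule achieves_if_wp)
  have a: "m + m < L - 2" "2 < L" "Suc 0 < L" "0 < L"
    using m_le by linarith+
  then have "xs ! 0 = n" "xs ! Suc 0 = m" "xs ! Suc (Suc (m + m)) = length ws" "Suc (Suc (m + m)) < L"
    using input_header by (simp_all add: mult_2)
  then show "wp W scan_prog (scan_inv 0) (initial_state xs)"
    using a L_ge m_le length_ws_le
    by (simp add: scan_prog_def initial_state_def scan_inv_def addr_0 has_input_def)
qed (simp add: scan_prog_def)

lemma scan_step:
  assumes "k < length ws" "scan_inv k s"
  shows "achieves W skip_walk_prog 2 (scan_inv (Suc k)) s"
proof (rule achieves_if_wp)
  have "addr k < L" "addr k + 2 * len k + 2 \<le> L"
    using addr_Suc_le[OF assms(1)] by linarith+
  moreover from this have "snd s (addr k) = len k"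
    using assms input_len by (simp add: scan_inv_def has_input_def)
  ultimately show "wp W skip_walk_prog (scan_inv (Suc k)) s"
    using assms length_ws_le by (simp add: skip_walk_prog_def scan_inv_def addr_Suc)
qed (simp add: skip_walk_prog_def)

lemma scan: "achieves W (While (Less (Const 0) (Reg 3)) skip_walk_prog) (3 * L + 1) (scan_inv (length ws)) s"
  if "scan_inv 0 s"
proof (rule achieves_mono)
  show "achieves W (While (Less (Const 0) (Reg 3)) skip_walk_prog)
      ((\<Sum>i<length ws. 2 + 1) + 1) (scan_inv (length ws)) s"
    by (rule achieves_While[OF _ scan_step _ that]) (simp_all add: scan_inv_def)
qed (use length_ws_le in simp_all)

text \<open>The cells after the slots must stay 0 because they become the signature bits, with 0 as
  the default for edges on no walk.\<close>

definition slots_inv :: "nat \<Rightarrow> state \<Rightarrow> bool" where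
  "slots_inv i s \<longleftrightarrow> frame s \<and> fst s 3 = i \<and> has_slots (slot_list i) (snd s) \<and>
     (\<forall>a\<ge>L + 3 * n. snd s a = 0)"

lemma slots_init: "achieves W (Assign 3 (Const 0)) 1 (slots_inv 0) s" if "scan_inv (length ws) s"
proof (rule achieves_if_wp)
  have "slot_list 0 v ! j = 0" if "j < 3" for v j
  proof -
    have "j = 0 \<or> j = 1 \<or> j = 2" using that by auto
    then show ?thesis by (auto simp: slot_list_def incident_inds_def)
  qed
  then show "wp W (Assign 3 (Const 0)) (slots_inv 0) s"
    using that by (simp add: scan_inv_def slots_inv_def frame_def addr_length has_slots_def)
qed simp

lemma slots_step:
  assumes i: "i < m" and inv: "slots_inv i s"
  shows "achieves W edge_prog 9 (slots_inv (Suc i)) s"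
proof (rule achieves_if_wp)
  let ?u = "fst (es ! i)" and ?w = "snd (es ! i)"
  let ?S = "(slot_list i)(?u := i # slot_list i ?u)"
  let ?h = "push_mem (L + 3 * ?u) i (snd s)"
  note uw = endpoints[OF i]
  have frame: "fst s 0 = L" "fst s 1 = n" "fst s 2 = m" "fst s 3 = i" "has_input (snd s)"
    and slots: "has_slots (slot_list i) (snd s)"
    using inv by (simp_all add: slots_inv_def frame_def)
  have S: "has_slots ?S ?h"
    using has_slots_push[OF slots uw(1)] .
  have S': "has_slots (slot_list (Suc i)) (push_mem (L + 3 * ?w) i ?h)"
    using has_slots_push[OF S uw(2), of i] slot_list_Suc[OF i] by (simp add: Let_def)
  have input: "has_input ?h" using has_input_push frame by simp
  have a: "2 + (i + i) < L" "3 + (i + i) < L" using i m_le by linarith+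
  \<comment> \<open>The second end is read after the first push, which has left the input
    intact.\<close>
  have u: "snd s (2 + (i + i)) = ?u" and w: "?h (3 + (i + i)) = ?w"
    using frame input a input_edge[OF i] by (simp_all only: has_input_def mult_2)
  have slot0: "h (L + 3 * v) = T v ! 0" "h (L + 3 * v + 1) = T v ! 1" if "has_slots T h" "v < n" for T h v
    using that(1)[unfolded has_slots_def, rule_format, OF that(2), of 0]
      that(1)[unfolded has_slots_def, rule_format, OF that(2), of 1] by simp_all
  \<comment> \<open>A push copies old entries, and each copy is subject to the word bound. Entries
    are edge positions or padding.\<close>
  have le: "snd s (L + 3 * ?u) \<le> W" "snd s (L + 3 * ?u + 1) \<le> W"
    "?h (L + 3 * ?w) \<le> W" "?h (L + 3 * ?w + 1) \<le> W"
    using slot0[OF slots uw(1)] slot0[OF S uw(2)] slot_list_less[of i _ ?u] slot_list_less[of i _ ?w] i uw(3) L_ge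
    by (auto intro: le_trans[of _ m])
  have bound: "L + 3 * ?u + 2 \<le> W" "L + 3 * ?w + 2 \<le> W" "i \<le> W"
    using uw L_ge i by simp_all
  have zero: "push_mem (L + 3 * ?w) i ?h a = 0" if "L + 3 * n \<le> a" for a
    using that uw inv by (auto simp: push_mem_def slots_inv_def)
  show "wp W edge_prog (slots_inv (Suc i)) s"
    unfolding edge_prog_def wp.simps(3)
  proof (rule wp_push[where b = "L + 3 * ?u"])
    have "wp W (push (Mem (Add (Const 3) (Add (Reg 3) (Reg 3)))))
      (wp W (Assign 3 (Add (Reg 3) (Const 1))) (slots_inv (Suc i))) ((fst s)(4 := L + 3 * ?u), ?h)"
    proof (rule wp_push[where b = "L + 3 * ?w"])
    qed (use frame w le bound S' input has_input_push[of ?h "3 * ?w" i] zero i L_ge in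
        \<open>simp_all add: slots_inv_def frame_def\<close>)
    then show "wp W (push (Mem (Add (Const 3) (Add (Reg 3) (Reg 3)))))
      (wp W (Assign 3 (Add (Reg 3) (Const 1))) (slots_inv (Suc i)))
      ((fst s)(4 := L + 3 * ?u), push_mem (L + 3 * ?u) (fst s 3) (snd s))"
      using frame by simp
  qed (use frame u le bound in simp_all)
qed (simp add: edge_prog_def cost_push)

lemma fill_slots: "achieves W (While (Less (Reg 3) (Reg 2)) edge_prog) (10 * L + 1) (slots_inv m) s"
  if "slots_inv 0 s"
proof (rule achieves_mono)
  show "achieves W (While (Less (Reg 3) (Reg 2)) edge_prog) ((\<Sum>i<m. 9 + 1) + 1) (slots_inv m) s"
    by (rule achieves_While[OF _ slots_step _ that]) (simp_all add: slots_inv_def frame_def)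
qed (use L_ge in simp_all)

definition ready :: "state \<Rightarrow> bool" where
  "ready s \<longleftrightarrow> frame s \<and> fst s 6 = L + 3 * n \<and>
     (\<forall>v<n. \<forall>j<3. snd s (L + 3 * v + j) = slot v j) \<and>
     (\<forall>i<m. snd s (L + 3 * n + i) \<in> {0, 1})"

definition marked :: "nat \<Rightarrow> nat \<Rightarrow> state \<Rightarrow> bool" where
  "marked k j s \<longleftrightarrow> (\<forall>i<j. snd s (L + 3 * n + inds k ! i) = twist k i)"

definition walks_inv :: "nat \<Rightarrow> state \<Rightarrow> bool" where
  "walks_inv k s \<longleftrightarrow> ready s \<and> fst s 5 = addr k \<and> (\<forall>k'<k. marked k' (len k') s)"

definition steps_inv :: "nat \<Rightarrow> nat \<Rightarrow> state \<Rightarrow> bool" where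
  "steps_inv k j s \<longleftrightarrow> ready s \<and> fst s 5 = addr (Suc k) \<and> fst s 7 = addr k + 1 + j \<and>
     fst s 8 = addr k + len k + 2 \<and> fst s 9 = addr k + len k + 2 + j \<and>
     fst s 10 = prev_ind k j \<and> (\<forall>k'<k. marked k' (len k') s) \<and> marked k j s"

lemma walks_init:
  assumes "slots_inv m s"
  shows "achieves W (Seq (Assign 5 (Add (Const 3) (Add (Reg 2) (Reg 2))))
        (Assign 6 (Add (Reg 0) (Add (Reg 1) (Add (Reg 1) (Reg 1)))))) 2 (walks_inv 0) s"
proof (rule achieves_if_wp)
  have "snd s (L + 3 * v + j) = slot v j" if "v < n" "j < 3" for v j
    using assms that slot_list_m by (simp add: slots_inv_def has_slots_def)
  then show "wp W (Seq (Assign 5 (Add (Const 3) (Add (Reg 2) (Reg 2))))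
        (Assign 6 (Add (Reg 0) (Add (Reg 1) (Add (Reg 1) (Reg 1)))))) (walks_inv 0) s"
    using assms L_ge
    by (simp add: slots_inv_def frame_def walks_inv_def ready_def addr_0)
qed simp

lemma prev_ind_Suc: "j < len k \<Longrightarrow> prev_ind k (Suc j) = inds k ! j"
  by (simp add: prev_ind_def)

lemma prev_ind_0: "0 < len k \<Longrightarrow> prev_ind k 0 = inds k ! (len k - 1)"
  by (simp add: prev_ind_def)

lemma walk_init:
  assumes k: "k < length ws" and inv: "walks_inv k s"
  shows "achieves W walk_init_prog 5 (steps_inv k 0) s"
proof (rule achieves_if_wp)
  have le: "addr k + 2 * len k + 2 \<le> L" "0 < len k"
    using addr_Suc_le[OF k] len_pos[OF k] by linarith+
  have "frame s" using inv by (simp add: walks_inv_def ready_def)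
  then have l: "snd s (addr k) = len k"
    using frame_read[of s "addr k"] input_len[OF k] le by simp
  \<comment> \<open>The last word of the block is the last edge of the walk, which precedes the
    first edge cyclically.\<close>
  have "addr k + len k + 2 + (len k - 1) = addr k + len k + 1 + len k" using le by simp
  then have p: "snd s (Suc (addr k + (len k + len k))) = prev_ind k 0"
    using frame_read[OF \<open>frame s\<close>, of "addr k + len k + 2 + (len k - 1)"] input_ind[OF k, of "len k - 1"]
      le prev_ind_0[of k] by (simp add: add.assoc)
  have "prev_ind k 0 < m" using walk_corner(1)[OF k] by simp
  then show "wp W walk_init_prog (steps_inv k 0) s"
    using inv l p le L_ge
    by (simp add: walk_init_prog_def walks_inv_def steps_inv_def ready_def frame_def addr_Suc
        marked_def add_ac)
qed (simp add: walk_init_prog_def)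

text \<open>The bit may be stored for an edge that is marked already. By \<open>twist_unique\<close>
  the value does not change, so no earlier mark is lost.\<close>

lemma steps_inv_store:
  assumes k: "k < length ws" and j: "j < len k" and inv: "steps_inv k j s"
    and h: "h = (snd s)(L + 3 * n + inds k ! j := twist k j)"
    and regs: "\<And>q. q \<in> {0, 1, 2, 5, 6, 8} \<Longrightarrow> g q = fst s q"
      "g 7 = Suc (fst s 7)" "g 9 = Suc (fst s 9)" "g 10 = inds k ! j"
  shows "steps_inv k (Suc j) (g, h)"
proof -
  have e: "inds k ! j < m" using inds k j by simp
  have "ready (g, h)"
  proof -
    have "has_input h"
      using inv by (simp add: h steps_inv_def ready_def frame_def has_input_def)
    moreover have "h (L + 3 * v + i) = slot v i" if "v < n" "i < 3" for v i
      using inv that by (auto simp: h steps_inv_def ready_def)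
    moreover have "h (L + 3 * n + i) \<in> {0, 1}" if "i < m" for i
      using inv that by (auto simp: h steps_inv_def ready_def twist_def)
    ultimately show ?thesis
      using inv regs(1) by (simp add: steps_inv_def ready_def frame_def)
  qed
  moreover have mark: "h (L + 3 * n + inds k' ! i) = twist k' i"
    if "k' < length ws" "i < len k'" "snd s (L + 3 * n + inds k' ! i) = twist k' i" for k' i
    using that twist_unique[OF that(1,2) k j] by (auto simp: h)
  have "marked k' (len k') (g, h)" if "k' < k" for k'
    using inv that k mark by (simp add: steps_inv_def marked_def)
  moreover have "marked k (Suc j) (g, h)"
    using inv k j mark by (auto simp: steps_inv_def marked_def less_Suc_eq h)
  ultimately show ?thesis
    using inv regs j by (simp add: steps_inv_def prev_ind_Suc)
qed

text \<open>Used at \<open>j\<close> and at \<open>Suc j\<close> for the two ends of an edge, so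
  \<open>j = len k\<close> must be allowed.\<close>

lemma wp_turn:
  assumes k: "k < length ws" and j: "j \<le> len k" and s: "ready s"
    and v: "expr_val v s = verts k ! j" and a: "fst s a = prev_ind k j"
    and e: "fst s e = inds k ! (j mod len k)" and "r \<noteq> a" "r \<noteq> e"
    and Q: "Q ((fst s)(r := of_bool (turn rot (Cs ! k) j)), snd s)"
  shows "wp W (turn_prog r v a e) Q s"
proof (rule wp_turn_prog)
  let ?v = "verts k ! j"
  have v': "?v < n" using verts_less[OF k j] .
  show "L + 3 * ?v = fst s 0 + 3 * expr_val v s"
    using s v by (simp add: ready_def frame_def)
  show "L + 3 * ?v \<le> W" "1 \<le> W" using v' L_ge by simp_all
  have read: "snd s (L + 3 * ?v) = slot ?v 0" "snd s (L + 3 * ?v + 1) = slot ?v 1"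
    "snd s (L + 3 * ?v + 2) = slot ?v 2"
  proof -
    have "\<forall>i<3. snd s (L + 3 * ?v + i) = slot ?v i" using s v' by (simp add: ready_def)
    from this[rule_format, of 0] this[rule_format, of 1] this[rule_format, of 2]
    show "snd s (L + 3 * ?v) = slot ?v 0" "snd s (L + 3 * ?v + 1) = slot ?v 1"
      "snd s (L + 3 * ?v + 2) = slot ?v 2" by simp_all
  qed
  have "prev_ind k j \<in> {slot ?v 0, slot ?v 1, slot ?v 2}"
    using walk_corner(1,3)[OF k j] slots(3)[OF v'] by blast
  then show "fst s a \<in> {snd s (L + 3 * ?v), snd s (L + 3 * ?v + 1), snd s (L + 3 * ?v + 2)}"
    unfolding read a .
  show "Q ((fst s)(r := of_bool (three_cycle (snd s (L + 3 * ?v)) (snd s (L + 3 * ?v + 1))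
      (snd s (L + 3 * ?v + 2)) (fst s a) = fst s e)), snd s)"
    using Q walk_corner(4)[OF k j] unfolding read a e by simp
qed fact+

lemma ready_regs: "ready (g, h) \<Longrightarrow> (\<And>q. q \<in> {0, 1, 2, 6} \<Longrightarrow> g' q = g q) \<Longrightarrow> ready (g', h)"
  by (simp add: ready_def frame_def)

lemma walk_step:
  assumes k: "k < length ws" and j: "j < len k" and inv: "steps_inv k j s"
  shows "achieves W step_prog 34 (steps_inv k (Suc j)) s"
proof (rule achieves_if_wp)
  let ?e = "inds k ! j" and ?f = "inds k ! (Suc j mod len k)"
  let ?t = "turn rot (Cs ! k)"
  obtain g h where s: "s = (g, h)" by (cases s)
  have le: "addr k + 2 * len k + 2 \<le> L" using addr_Suc_le[OF k] .
  have rd: "ready (g, h)" and regs: "g 5 = addr k + 2 * len k + 2" "g 7 = addr k + 1 + j"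
    "g 8 = addr k + len k + 2" "g 9 = addr k + len k + 2 + j" "g 10 = prev_ind k j" "g 6 = L + 3 * n"
    using inv by (simp_all add: s steps_inv_def addr_Suc ready_def)
  have frame: "frame (g, h)" using rd by (simp add: ready_def)
  have read: "h (addr k + len k + 2 + i) = inds k ! i" if "i < len k" for i
    using frame_read[OF frame, of "addr k + len k + 2 + i"] input_ind[OF k that] that le by simp
  have vert: "h (addr k + 1 + i) = verts k ! i" if "i \<le> len k" for i
    using frame_read[OF frame, of "addr k + 1 + i"] input_vert[OF k that] that le by simp
  have e: "?e < m" "?f < m"
    using inds[OF k j] walk_corner(2)[OF k, of "Suc j"] j by simp_all
  have next_ind: "(if Suc (g 9) < g 5 then h (Suc (g 9)) else h (g 8)) = ?f"
  proof (cases "Suc j < len k")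
    case True
    then show ?thesis using read[of "Suc j"] regs by simp
  next
    case False
    then have "Suc j = len k" using j by simp
    moreover have "0 < len k" using j by linarith
    ultimately show ?thesis using read[OF \<open>0 < len k\<close>] regs by simp
  qed
  \<comment> \<open>Registers after loading the edges, after the first turn with the move to the
    next vertex, and after the second turn.\<close>
  define g1 where "g1 = g(11 := ?e, 9 := Suc (g 9), 12 := ?f)"
  define g2 where "g2 = g1(13 := of_bool (?t j), 7 := Suc (g 7))"
  define g3 where "g3 = g2(14 := of_bool (?t (Suc j)))"
  have mark: "wp W mark_prog (steps_inv k (Suc j)) (g3, h)"
  proof -
    have "steps_inv k (Suc j) (g3(10 := ?e), h(L + 3 * n + ?e := twist k j))"
      by (rule steps_inv_store[OF k j inv]) (auto simp: s g1_def g2_def g3_def)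
    moreover have "twist k j = (if g3 13 = g3 14 then 0 else 1)"
      by (simp add: twist_def g3_def g2_def)
    moreover have "g3 6 = L + 3 * n" "g3 11 = ?e"
      using regs by (simp_all add: g1_def g2_def g3_def)
    ultimately show ?thesis using e L_ge by (cases "g3 13 = g3 14") (simp_all add: mark_prog_def)
  qed
  have turn2: "wp W (turn_prog 14 (Mem (Reg 7)) 11 12) (wp W mark_prog (steps_inv k (Suc j))) (g2, h)"
  proof (rule wp_turn[OF k])
    show "ready (g2, h)" using rd by (rule ready_regs) (auto simp: g1_def g2_def)
  qed (use mark j vert[of "Suc j"] regs in \<open>simp_all add: g1_def g2_def g3_def prev_ind_Suc\<close>)
  have turn1: "wp W turns_prog (steps_inv k (Suc j)) (g1, h)"
    unfolding turns_prog_def wp.simps(3)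
  proof (rule wp_turn[OF k])
    show "ready (g1, h)" using rd by (rule ready_regs) (auto simp: g1_def)
    have "g 7 + 1 \<le> W" using regs le j by simp
    then show "wp W (Assign 7 (Add (Reg 7) (Const 1)))
      (wp W (turn_prog 14 (Mem (Reg 7)) 11 12) (wp W mark_prog (steps_inv k (Suc j))))
      ((fst (g1, h))(13 := of_bool (?t j)), snd (g1, h))"
      using turn2 by (simp add: g2_def g1_def)
  qed (use j vert[of j] regs in \<open>simp_all add: g1_def\<close>)
  have b: "?e \<le> W" "?f \<le> W" "Suc (g 9) \<le> W" "h (g 9) = ?e"
    using e L_ge regs le j read[OF j] by simp_all
  show "wp W step_prog (steps_inv k (Suc j)) s"
    using turn1 b next_ind by (auto simp: step_prog_def s g1_def split: if_splits)
qed (simp add: step_prog_def turns_prog_def mark_prog_def cost_turn_prog)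

lemma walk_body:
  assumes k: "k < length ws" and inv: "walks_inv k s"
  shows "achieves W (Seq walk_init_prog (While (Less (Reg 9) (Reg 5)) step_prog))
    (35 * len k + 6) (walks_inv (Suc k)) s"
proof -
  have "achieves W (While (Less (Reg 9) (Reg 5)) step_prog) (35 * len k + 1) (walks_inv (Suc k)) s"
    if "steps_inv k 0 s" for s
  proof (rule achieves_mono)
    show "achieves W (While (Less (Reg 9) (Reg 5)) step_prog) ((\<Sum>j<len k. 34 + 1) + 1) (steps_inv k (len k)) s"
      by (rule achieves_While[OF _ walk_step[OF k] _ that]) (simp_all add: steps_inv_def addr_Suc)
    show "walks_inv (Suc k) s" if "steps_inv k (len k) s" for s
      using that by (auto simp: steps_inv_def walks_inv_def less_Suc_eq)
  qed simp
  from achieves_Seq[OF walk_init[OF k inv] this] show ?thesis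
    by (rule achieves_mono) simp_all
qed

text \<open>The time spent on a walk is charged to its own block of \<open>2 * len k + 2\<close>
  words. The blocks are disjoint parts of the input, so the nested loops are linear
  together.\<close>

lemma walks:
  assumes "walks_inv 0 s"
  shows "achieves W (While (Less (Reg 5) (Reg 0))
      (Seq walk_init_prog (While (Less (Reg 9) (Reg 5)) step_prog)))
    (35 * L + 1) (walks_inv (length ws)) s"
proof (rule achieves_mono)
  show "achieves W (While (Less (Reg 5) (Reg 0))
      (Seq walk_init_prog (While (Less (Reg 9) (Reg 5)) step_prog)))
    ((\<Sum>k<length ws. 35 * len k + 6 + 1) + 1) (walks_inv (length ws)) s"
  proof (rule achieves_While[OF _ walk_body _ assms])
    fix k s assume "k < length ws" "walks_inv k s"
    then show "cond_val (Less (Reg 5) (Reg 0)) s"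
      using addr_Suc_le[of k] by (simp add: walks_inv_def ready_def frame_def)
  qed (simp_all add: walks_inv_def ready_def frame_def addr_length)
  have "(\<Sum>k<length ws. 35 * len k + 6 + 1) \<le> 35 * (\<Sum>k<length ws. 2 * len k + 2)"
    by (simp only: sum_distrib_left) (rule sum_mono, simp)
  also have "\<dots> \<le> 35 * L"
    using addr_length unfolding addr_def by linarith
  finally show "(\<Sum>k<length ws. 35 * len k + 6 + 1) + 1 \<le> 35 * L + 1" by simp
qed

text \<open>The slope 48 is 3 + 10 + 35, from the three phases.\<close>

lemma embedding_prog: "achieves W embedding_prog (48 * L + 11) (walks_inv (length ws)) (initial_state xs)"
proof -
  note rest = achieves_Seq[OF walks_init walks]
  note rest = achieves_Seq[OF fill_slots rest]
  note rest = achieves_Seq[OF slots_init rest]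
  note rest = achieves_Seq[OF scan rest]
  note rest = achieves_Seq[OF scan_init rest]
  from rest show ?thesis
    unfolding embedding_prog_def by (rule achieves_mono) simp_all
qed

lemma embedding_found:
  assumes "walks_inv (length ws) s"
  shows "\<exists>ys. outputs s ys \<and> embedding_solution (n, es, ws) ys"
proof (intro exI conjI)
  let ?ys = "map (\<lambda>a. snd s (L + a)) [0..<3 * n + m]"
  show "outputs s ?ys"
    using assms by (simp add: outputs_def walks_inv_def ready_def frame_def)
  show "embedding_solution (n, es, ws) ?ys"
  proof (rule embedding_solution)
    show "?ys ! (3 * v + j) = slot v j" if "v < n" "j < 3" for v j
      using assms that by (simp add: walks_inv_def ready_def flip: add.assoc)
    show "?ys ! (3 * n + i) \<in> {0, 1}" if "i < m" for i
      using assms that by (simp add: walks_inv_def ready_def flip: add.assoc)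
    show "?ys ! (3 * n + inds k ! j) = twist k j" if "k < length ws" "j < len k" for k j
      using assms that inds[OF that] by (simp add: walks_inv_def marked_def flip: add.assoc)
  qed simp
qed

end

lemma linear_time:
  "linear_time_solvable bridgeless_cubic_instances encode_instance embedding_solution"
  unfolding linear_time_solvable_def
\<comment> \<open>The constant 100 serves as time bound, where it exceeds 48 and 11, and as the
  factor in the word bound \<open>W\<close>.\<close>
proof (rule exI[of _ embedding_prog], rule exI[of _ 100], rule ballI)
  fix x :: graph_instance
  assume x: "x \<in> bridgeless_cubic_instances"
  obtain n es ws where xdef: "x = (n, es, ws)" by (metis prod_cases3)
  interpret embedding_instance n es ws
    using x xdef by unfold_locales simp
  obtain k s where ks: "exec W embedding_prog (initial_state xs) k s" "k \<le> 48 * L + 11"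
    "walks_inv (length ws) s"
    using embedding_prog unfolding achieves_def by blast
  then obtain ys where "outputs s ys" "embedding_solution (n, es, ws) ys"
    using embedding_found by blast
  then show "\<exists>k s ys. exec (100 * (length (encode_instance x) + 1)) embedding_prog
      (initial_state (encode_instance x)) k s \<and>
    k \<le> 100 * (length (encode_instance x) + 1) \<and> outputs s ys \<and> embedding_solution x ys"
    using ks unfolding xdef by (intro exI[of _ k] exI[of _ s] exI[of _ ys]) simp
qed

theorem lemma5:
  shows "(\<forall>(V :: 'a set) E Cs.
            simple_graph V E \<and> cubic V E \<and> bridgeless V E \<and>
            partial_CDC V E Cs \<longrightarrow>
            (\<exists>\<pi> \<sigma>. embedding V E \<pi> \<sigma> \<and> some_facial_walks E \<pi> \<sigma> Cs)) \<and>
         linear_time_solvable bridgeless_cubic_instances encode_instance embedding_solution"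
  using ex_embedding linear_time by blast

end
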